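(* Let $k$ be a field and let $R=k[t_1^{\pm1},\dots,t_d^{\pm1},t_{d+1},\dots,t_n]$. Then the isotopes of the split octonion algebra over $R$ are split.
   Context: An octonion algebra over $R$ is a unital (not necessarily associative) $R$-algebra whose underlying module is projective of constant rank 8, endowed with a regular multiplicative quadratic form. The split octonion algebra over $R$ is Zorn's algebra of vector matrices $\begin{pmatrix}\alpha&u\\ v&\beta\end{pmatrix}$, $\alpha,\beta\in R$, $u,v\in R^3$, with product $$\begin{pmatrix}\alpha&u\\ v&\beta\end{pmatrix}\begin{pmatrix}\alpha'&u'\\ v'&\beta'\end{pmatrix}=\begin{pmatrix}\alpha\alpha'+u\cdot v'&\alpha u'+\beta'u-v\times v'\\ \alpha'v+\beta v'+u\times u'&\beta\beta'+v\cdot u'\end{pmatrix}$$ and norm $\alpha\beta-u\cdot v$; an octonion algebra is split if it is isomorphic to this one. An isotope of an octonion algebra $C$ means a unital algebra isotopic to $C$, i.e. (up to isomorphism) an algebra $C^{a,b}$ with $a,b\in C$ invertible, where $C^{a,b}$ is the $R$-module $C$ with multiplication $x*y=(xa)(by)$ (products in $C$ on the right). *)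

theory Defs
  imports "HOL-Library.Poly_Mapping" "HOL-Algebra.Module"
begin

section \<open>Unital nonassociative algebras\<close>

text \<open>
  The record type \<open>module\<close> of HOL-Algebra already carries a multiplication and a unit; the locale
  \<open>algebra\<close> of HOL-Algebra is restricted to commutative associative algebras.
\<close>

locale unital_algebra = module R A for R (structure) and A (structure) +
  assumes mult_closed:
      "\<lbrakk>x \<in> carrier A; y \<in> carrier A\<rbrakk> \<Longrightarrow> x \<otimes>\<^bsub>A\<^esub> y \<in> carrier A"
    and mult_l_distr:
      "\<lbrakk>x \<in> carrier A; y \<in> carrier A; z \<in> carrier A\<rbrakk> \<Longrightarrow>
        (x \<oplus>\<^bsub>A\<^esub> y) \<otimes>\<^bsub>A\<^esub> z = x \<otimes>\<^bsub>A\<^esub> z \<oplus>\<^bsub>A\<^esub> y \<otimes>\<^bsub>A\<^esub> z"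
    and mult_r_distr:
      "\<lbrakk>x \<in> carrier A; y \<in> carrier A; z \<in> carrier A\<rbrakk> \<Longrightarrow>
        x \<otimes>\<^bsub>A\<^esub> (y \<oplus>\<^bsub>A\<^esub> z) = x \<otimes>\<^bsub>A\<^esub> y \<oplus>\<^bsub>A\<^esub> x \<otimes>\<^bsub>A\<^esub> z"
    and mult_smult_left:
      "\<lbrakk>r \<in> carrier R; x \<in> carrier A; y \<in> carrier A\<rbrakk> \<Longrightarrow>
        (r \<odot>\<^bsub>A\<^esub> x) \<otimes>\<^bsub>A\<^esub> y = r \<odot>\<^bsub>A\<^esub> (x \<otimes>\<^bsub>A\<^esub> y)"
    and mult_smult_right:
      "\<lbrakk>r \<in> carrier R; x \<in> carrier A; y \<in> carrier A\<rbrakk> \<Longrightarrow>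
        x \<otimes>\<^bsub>A\<^esub> (r \<odot>\<^bsub>A\<^esub> y) = r \<odot>\<^bsub>A\<^esub> (x \<otimes>\<^bsub>A\<^esub> y)"
    and unit_closed: "\<one>\<^bsub>A\<^esub> \<in> carrier A"
    and unit_left: "x \<in> carrier A \<Longrightarrow> \<one>\<^bsub>A\<^esub> \<otimes>\<^bsub>A\<^esub> x = x"
    and unit_right: "x \<in> carrier A \<Longrightarrow> x \<otimes>\<^bsub>A\<^esub> \<one>\<^bsub>A\<^esub> = x"

definition alg_iso ::
    "('r, 'm) ring_scheme \<Rightarrow> ('r, 'a, 'p) module_scheme \<Rightarrow> ('r, 'b, 'q) module_scheme \<Rightarrow> ('a \<Rightarrow> 'b) set" where
  "alg_iso R A B =
    {f. bij_betw f (carrier A) (carrier B) \<and>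
        (\<forall>x\<in>carrier A. \<forall>y\<in>carrier A. f (x \<oplus>\<^bsub>A\<^esub> y) = f x \<oplus>\<^bsub>B\<^esub> f y) \<and>
        (\<forall>r\<in>carrier R. \<forall>x\<in>carrier A. f (r \<odot>\<^bsub>A\<^esub> x) = r \<odot>\<^bsub>B\<^esub> f x) \<and>
        (\<forall>x\<in>carrier A. \<forall>y\<in>carrier A. f (x \<otimes>\<^bsub>A\<^esub> y) = f x \<otimes>\<^bsub>B\<^esub> f y) \<and>
        f \<one>\<^bsub>A\<^esub> = \<one>\<^bsub>B\<^esub>}"

definition alg_isomorphic ::
    "('r, 'm) ring_scheme \<Rightarrow> ('r, 'a, 'p) module_scheme \<Rightarrow> ('r, 'b, 'q) module_scheme \<Rightarrow> bool" where
  "alg_isomorphic R A B \<longleftrightarrow> alg_iso R A B \<noteq> {}"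


section \<open>Isotopes\<close>

definition alg_invertible :: "('r, 'a, 'p) module_scheme \<Rightarrow> 'a \<Rightarrow> bool" where
  "alg_invertible C a \<longleftrightarrow>
    a \<in> carrier C \<and> (\<exists>b\<in>carrier C. a \<otimes>\<^bsub>C\<^esub> b = \<one>\<^bsub>C\<^esub> \<and> b \<otimes>\<^bsub>C\<^esub> a = \<one>\<^bsub>C\<^esub>)"

text \<open>
  The algebra \<open>C\<^sup>a\<^sup>,\<^sup>b\<close>, on the same module as \<open>C\<close>. For \<open>C\<close> an octonion algebra and \<open>a\<close>, \<open>b\<close>
  invertible, its unit is the inverse of \<open>a b\<close>; being determined by the new multiplication, it
  can be given by a definite description.
\<close>

definition isotope_alg :: "('r, 'a) module \<Rightarrow> 'a \<Rightarrow> 'a \<Rightarrow> ('r, 'a) module" where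
  "isotope_alg C a b =
    C\<lparr>mult := (\<lambda>x y. (x \<otimes>\<^bsub>C\<^esub> a) \<otimes>\<^bsub>C\<^esub> (b \<otimes>\<^bsub>C\<^esub> y)),
      one := (THE e. e \<in> carrier C \<and>
        (\<forall>x\<in>carrier C. (e \<otimes>\<^bsub>C\<^esub> a) \<otimes>\<^bsub>C\<^esub> (b \<otimes>\<^bsub>C\<^esub> x) = x \<and>
                        (x \<otimes>\<^bsub>C\<^esub> a) \<otimes>\<^bsub>C\<^esub> (b \<otimes>\<^bsub>C\<^esub> e) = x))\<rparr>"

definition isotope_of ::
    "('r, 'm) ring_scheme \<Rightarrow> ('r, 'b, 'q) module_scheme \<Rightarrow> ('r, 'a) module \<Rightarrow> bool" where
  "isotope_of R A C \<longleftrightarrow>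
    unital_algebra R A \<and>
    (\<exists>a b. alg_invertible C a \<and> alg_invertible C b \<and> alg_isomorphic R A (isotope_alg C a b))"


section \<open>Zorn's algebra of vector matrices\<close>

type_synonym 'r vec3 = "'r \<times> 'r \<times> 'r"

definition vadd3 :: "('r, 'm) ring_scheme \<Rightarrow> 'r vec3 \<Rightarrow> 'r vec3 \<Rightarrow> 'r vec3" where
  "vadd3 R = (\<lambda>(x1, x2, x3) (y1, y2, y3). (x1 \<oplus>\<^bsub>R\<^esub> y1, x2 \<oplus>\<^bsub>R\<^esub> y2, x3 \<oplus>\<^bsub>R\<^esub> y3))"

definition vsub3 :: "('r, 'm) ring_scheme \<Rightarrow> 'r vec3 \<Rightarrow> 'r vec3 \<Rightarrow> 'r vec3" where
  "vsub3 R = (\<lambda>(x1, x2, x3) (y1, y2, y3). (x1 \<ominus>\<^bsub>R\<^esub> y1, x2 \<ominus>\<^bsub>R\<^esub> y2, x3 \<ominus>\<^bsub>R\<^esub> y3))"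

definition vsmult3 :: "('r, 'm) ring_scheme \<Rightarrow> 'r \<Rightarrow> 'r vec3 \<Rightarrow> 'r vec3" where
  "vsmult3 R = (\<lambda>r (x1, x2, x3). (r \<otimes>\<^bsub>R\<^esub> x1, r \<otimes>\<^bsub>R\<^esub> x2, r \<otimes>\<^bsub>R\<^esub> x3))"

definition dot3 :: "('r, 'm) ring_scheme \<Rightarrow> 'r vec3 \<Rightarrow> 'r vec3 \<Rightarrow> 'r" where
  "dot3 R = (\<lambda>(x1, x2, x3) (y1, y2, y3).
    x1 \<otimes>\<^bsub>R\<^esub> y1 \<oplus>\<^bsub>R\<^esub> x2 \<otimes>\<^bsub>R\<^esub> y2 \<oplus>\<^bsub>R\<^esub> x3 \<otimes>\<^bsub>R\<^esub> y3)"

definition vcross3 :: "('r, 'm) ring_scheme \<Rightarrow> 'r vec3 \<Rightarrow> 'r vec3 \<Rightarrow> 'r vec3" where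
  "vcross3 R = (\<lambda>(x1, x2, x3) (y1, y2, y3).
    (x2 \<otimes>\<^bsub>R\<^esub> y3 \<ominus>\<^bsub>R\<^esub> x3 \<otimes>\<^bsub>R\<^esub> y2,
     x3 \<otimes>\<^bsub>R\<^esub> y1 \<ominus>\<^bsub>R\<^esub> x1 \<otimes>\<^bsub>R\<^esub> y3,
     x1 \<otimes>\<^bsub>R\<^esub> y2 \<ominus>\<^bsub>R\<^esub> x2 \<otimes>\<^bsub>R\<^esub> y1))"

text \<open>
  \<open>(\<alpha>, u, v, \<beta>)\<close> stands for the vector matrix with first row \<open>\<alpha>, u\<close> and second row \<open>v, \<beta>\<close>.
\<close>

type_synonym 'r zorn_matrix = "'r \<times> 'r vec3 \<times> 'r vec3 \<times> 'r"

definition zorn_mult :: "('r, 'm) ring_scheme \<Rightarrow> 'r zorn_matrix \<Rightarrow> 'r zorn_matrix \<Rightarrow> 'r zorn_matrix" where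
  "zorn_mult R = (\<lambda>(\<alpha>, u, v, \<beta>) (\<alpha>', u', v', \<beta>').
    (\<alpha> \<otimes>\<^bsub>R\<^esub> \<alpha>' \<oplus>\<^bsub>R\<^esub> dot3 R u v',
     vsub3 R (vadd3 R (vsmult3 R \<alpha> u') (vsmult3 R \<beta>' u)) (vcross3 R v v'),
     vadd3 R (vadd3 R (vsmult3 R \<alpha>' v) (vsmult3 R \<beta> v')) (vcross3 R u u'),
     \<beta> \<otimes>\<^bsub>R\<^esub> \<beta>' \<oplus>\<^bsub>R\<^esub> dot3 R v u'))"

definition zorn_algebra :: "('r, 'm) ring_scheme \<Rightarrow> ('r, 'r zorn_matrix) module" where
  "zorn_algebra R =
    \<lparr>carrier = carrier R \<times> (carrier R \<times> carrier R \<times> carrier R) \<times>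
               (carrier R \<times> carrier R \<times> carrier R) \<times> carrier R,
     mult = zorn_mult R,
     one = (\<one>\<^bsub>R\<^esub>, (\<zero>\<^bsub>R\<^esub>, \<zero>\<^bsub>R\<^esub>, \<zero>\<^bsub>R\<^esub>), (\<zero>\<^bsub>R\<^esub>, \<zero>\<^bsub>R\<^esub>, \<zero>\<^bsub>R\<^esub>), \<one>\<^bsub>R\<^esub>),
     zero = (\<zero>\<^bsub>R\<^esub>, (\<zero>\<^bsub>R\<^esub>, \<zero>\<^bsub>R\<^esub>, \<zero>\<^bsub>R\<^esub>), (\<zero>\<^bsub>R\<^esub>, \<zero>\<^bsub>R\<^esub>, \<zero>\<^bsub>R\<^esub>), \<zero>\<^bsub>R\<^esub>),
     add = (\<lambda>(\<alpha>, u, v, \<beta>) (\<alpha>', u', v', \<beta>').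
       (\<alpha> \<oplus>\<^bsub>R\<^esub> \<alpha>', vadd3 R u u', vadd3 R v v', \<beta> \<oplus>\<^bsub>R\<^esub> \<beta>')),
     smult = (\<lambda>r (\<alpha>, u, v, \<beta>).
       (r \<otimes>\<^bsub>R\<^esub> \<alpha>, vsmult3 R r u, vsmult3 R r v, r \<otimes>\<^bsub>R\<^esub> \<beta>))\<rparr>"

lemma zorn_unital_algebra:
  assumes "cring R"
  shows "unital_algebra R (zorn_algebra R)"
proof -
  interpret R: cring R by fact
  note defs = zorn_algebra_def zorn_mult_def vadd3_def vsub3_def vsmult3_def vcross3_def dot3_def
  note ring = R.minus_eq R.l_distr R.r_distr R.l_minus R.r_minus R.minus_add R.a_ac R.m_ac
  have "abelian_group (zorn_algebra R)"
    by (intro abelian_groupI) (auto simp: defs R.a_ac)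
  then have "module R (zorn_algebra R)"
    by (intro moduleI[OF assms]) (auto simp: defs R.l_distr R.r_distr R.m_assoc)
  then show ?thesis
    by (rule unital_algebra.intro, unfold_locales) (auto simp: defs ring)
qed

text \<open>
  The norm of an octonion algebra is not part of the data here: any algebra isomorphic to Zorn's
  is an octonion algebra, with the norm transported from \<open>\<alpha>\<beta> - u \<cdot> v\<close>.
\<close>

definition split_octonion :: "('r, 'm) ring_scheme \<Rightarrow> ('r, 'a, 'p) module_scheme \<Rightarrow> bool" where
  "split_octonion R A \<longleftrightarrow> unital_algebra R A \<and> alg_isomorphic R A (zorn_algebra R)"


section \<open>Mixed Laurent polynomial rings\<close>

text \<open>
  \<open>k[t\<^sub>1\<^sup>\<plusminus>\<^sup>1, \<dots>, t\<^sub>d\<^sup>\<plusminus>\<^sup>1, t\<^sub>d\<^sub>+\<^sub>1, \<dots>, t\<^sub>n]\<close>: a monomial is a finitely supported exponent vector,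
  whose entry at \<open>i\<close> is the exponent of \<open>t\<^sub>i\<close>. The multiplication \<open>*\<close> of finitely supported
  functions is convolution.
\<close>

definition mixed_exponents :: "nat \<Rightarrow> nat \<Rightarrow> (nat \<Rightarrow>\<^sub>0 int) set" where
  "mixed_exponents d n =
    {e. Poly_Mapping.keys e \<subseteq> {1..n} \<and> (\<forall>i>d. 0 \<le> Poly_Mapping.lookup e i)}"

definition mixed_laurent :: "nat \<Rightarrow> nat \<Rightarrow> ((nat \<Rightarrow>\<^sub>0 int) \<Rightarrow>\<^sub>0 'k::field) ring" where
  "mixed_laurent d n =
    \<lparr>carrier = {p. Poly_Mapping.keys p \<subseteq> mixed_exponents d n},
     mult = (*), one = 1, zero = 0, add = (+)\<rparr>"

lemma mixed_laurent_cring: "cring (mixed_laurent d n :: ((nat \<Rightarrow>\<^sub>0 int) \<Rightarrow>\<^sub>0 'k::field) ring)"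
proof (intro cringI abelian_groupI comm_monoidI)
  have add_exp: "e + e' \<in> mixed_exponents d n"
    if "e \<in> mixed_exponents d n" "e' \<in> mixed_exponents d n" for e e'
    using that Poly_Mapping.keys_add[of e e'] by (auto simp: mixed_exponents_def lookup_add)
  fix x y :: "(nat \<Rightarrow>\<^sub>0 int) \<Rightarrow>\<^sub>0 'k"
  assume xy: "x \<in> carrier (mixed_laurent d n)" "y \<in> carrier (mixed_laurent d n)"
  show "x \<otimes>\<^bsub>mixed_laurent d n\<^esub> y \<in> carrier (mixed_laurent d n)"
    using xy keys_mult[of x y] add_exp by (fastforce simp: mixed_laurent_def)
  show "x \<oplus>\<^bsub>mixed_laurent d n\<^esub> y \<in> carrier (mixed_laurent d n)"
    using xy Poly_Mapping.keys_add[of x y] by (auto simp: mixed_laurent_def)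
next
  fix x :: "(nat \<Rightarrow>\<^sub>0 int) \<Rightarrow>\<^sub>0 'k"
  assume "x \<in> carrier (mixed_laurent d n)"
  then show "\<exists>y\<in>carrier (mixed_laurent d n). y \<oplus>\<^bsub>mixed_laurent d n\<^esub> x = \<zero>\<^bsub>mixed_laurent d n\<^esub>"
    by (intro bexI[of _ "- x"]) (auto simp: mixed_laurent_def)
qed (auto simp: mixed_laurent_def mixed_exponents_def algebra_simps)

end

theory Submission
  imports Defs "HOL-Computational_Algebra.Polynomial" "HOL-Library.Product_Plus"
begin

text \<open>Let \<open>C\<close> be Zorn's algebra over \<open>R\<close> and \<open>f\<close> an isomorphism from \<open>A\<close> to \<open>C\<^sup>a\<^sup>,\<^sup>b\<close>. Then
  \<open>f (x y) = (f x \<cdot> a) (b \<cdot> f y)\<close>, so \<open>A\<close> comes with two linear maps \<open>G\<close> and \<open>H\<close> to \<open>C\<close> satisfying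
  \<open>f (x y) = G x \<cdot> H y\<close>. Put \<open>p = G 1\<close> and \<open>q = H 1\<close>; both have invertible norm. Composing with a
  linear bijection \<open>\<theta>\<^sub>1\<close> for which \<open>\<theta>\<^sub>1 (x y) = \<theta>\<^sub>2 x \<cdot> \<theta>\<^sub>3 y\<close> replaces \<open>(p, q)\<close> by
  \<open>(\<theta>\<^sub>2 p, \<theta>\<^sub>3 q)\<close>, and once both are \<open>1\<close> the three maps coincide and are an isomorphism from \<open>A\<close>
  to \<open>C\<close>. It is therefore enough to move an arbitrary \<open>q\<close> of invertible norm to \<open>1\<close> by a map
  \<open>\<theta>\<close> with \<open>\<theta> (x y) = \<tau> x \<cdot> \<theta> y\<close> and \<open>\<tau> 1 = 1\<close>: conjugation turns such a pair into one that acts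
  on the other factor, so \<open>p\<close> can be treated first and \<open>q\<close> afterwards (\<open>isotope_split\<close>).

  Up to similarity factors these \<open>\<theta>\<close> form the group \<open>Spin\<^sub>7\<close> in its spin representation, and the norm form is
  \<open>\<alpha>\<beta> - u \<cdot> v\<close>: up to signs, the pairing of the row \<open>(\<alpha>, u)\<close> in \<open>R\<^sup>4\<close> with its dual \<open>(\<beta>, v)\<close>.
  The group contains \<open>SL\<^sub>4\<close> acting on these two summands. Invertibility of the norm implies that the
  row \<open>(\<alpha>, u)\<close> is unimodular, so all that is needed is that \<open>SL\<^sub>4 (R)\<close> moves every unimodular
  row of length 4 to \<open>(1, 0, 0, 0)\<close>; afterwards \<open>v\<close> is cleared by \<open>SL\<^sub>2\<close> moves and the last entry by
  a diagonal map. All moves of rows used here are \<open>SL\<^sub>2\<close> moves on the first and one further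
  coordinate (\<open>sl2_step\<close>), because those lift to Zorn's algebra by one short formula.

  That unimodular rows over \<open>R\<close> can be moved to \<open>(1, 0, 0, 0)\<close> is the theorem of Quillen, Suslin
  and Swan. Its core is Suslin's elementary argument (\<open>sl2_equiv_poly_eval\<close>): over any commutative
  ring \<open>B\<close>, the values of a unimodular row over \<open>B[x]\<close> with a monic entry at two points of \<open>B\<close> are
  equivalent. Granted this, let \<open>a\<close> be a unimodular row over \<open>R\<close> with \<open>a\<^sub>1 \<noteq> 0\<close>, adjoin a Laurent
  variable \<open>x\<close>, and substitute
  \<open>t\<^sub>i \<mapsto> x\<^bsup>N\<^sub>i\<^esup> t\<^sub>i\<close> for the invertible variables and \<open>t\<^sub>j \<mapsto> t\<^sub>j + x\<^bsup>N\<^sub>j\<^esup> - x\<^bsup>-N\<^sub>j\<^esup>\<close> for the others.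
  Setting \<open>x = 1\<close> undoes the substitution. If the \<open>N\<close> are powers of a large number, distinct
  monomials of \<open>a\<^sub>1\<close> get distinct leading and distinct lowest exponents of \<open>x\<close>, so the new
  first entry has invertible coefficients at both ends: up to a power of \<open>x\<close> it is a polynomial
  \<open>P\<close> in \<open>x\<close> with invertible leading and constant coefficients. The variable \<open>x\<close> is invertible modulo \<open>P\<close>,
  so the other entries can be reduced to polynomials, and the resulting unimodular row over the
  polynomial ring has equivalent values at \<open>1\<close> and at \<open>0\<close>. The first value is
  equivalent to \<open>a\<close>, the second contains the unit \<open>P(0)\<close> (\<open>laurent_row_sl2_equiv\<close>).

  Suslin's argument is about polynomials over a type, while \<open>R\<close> is a subring whose shape depends on
  \<open>d\<close> and \<open>n\<close>. The substitution therefore takes its coefficients in one large ring, in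
  which every index has both an invertible and a polynomial variable; \<open>R\<close> is a retract of it by
  the map that keeps for each index the variable that it has in \<open>R\<close> (\<open>merge\<close>), and equivalences of
  rows are carried along ring homomorphisms.\<close>

section \<open>Ideals, and polynomials modulo a maximal ideal\<close>

text \<open>
  Ideals are the submodules of a ring over itself, which provides generated ideals
  (\<open>ideal.span\<close>) and their calculus.\<close>

interpretation ideal: Modules.module "(*) :: 'a::comm_ring_1 \<Rightarrow> 'a \<Rightarrow> 'a"
  by unfold_locales (simp_all add: algebra_simps)

\<comment> \<open>As a rewrite rule this one would reverse the usual reassociation of products.\<close>
declare ideal.scale_scale [simp del]

text \<open>
  The quotient by \<open>M\<close> is a field, expressed by congruences: that quotient is not a type, and all
  arguments below that take place in a residue field are carried out modulo \<open>M\<close>.\<close>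

definition maximal_ideal :: "'a::comm_ring_1 set \<Rightarrow> bool" where
  "maximal_ideal M \<longleftrightarrow> ideal.subspace M \<and> 1 \<notin> M \<and> (\<forall>a. a \<notin> M \<longrightarrow> (\<exists>b. a * b - 1 \<in> M))"

lemma ideal_mult_right: "ideal.subspace I \<Longrightarrow> x \<in> I \<Longrightarrow> x * r \<in> I"
  using ideal.subspace_scale[of I x r] by (simp add: mult.commute)

lemma maximal_ideal_exists:
  fixes J :: "'a::comm_ring_1 set"
  assumes J: "ideal.subspace J" "1 \<notin> J"
  obtains M where "maximal_ideal M" "J \<subseteq> M"
proof -
  define \<A> where "\<A> = {I :: 'a set. ideal.subspace I \<and> J \<subseteq> I \<and> 1 \<notin> I}"
  have "\<Union>\<C> \<in> \<A>" if C: "\<C> \<noteq> {}" "subset.chain \<A> \<C>" for \<C>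
  proof -
    have I: "ideal.subspace I" "J \<subseteq> I" "1 \<notin> I" if "I \<in> \<C>" for I
      using C that by (auto simp: \<A>_def subset.chain_def)
    have "ideal.subspace (\<Union>\<C>)"
    proof (rule ideal.subspaceI)
      show "0 \<in> \<Union>\<C>" using C(1) I(1) ideal.subspace_0 by blast
      show "x + y \<in> \<Union>\<C>" if xy: "x \<in> \<Union>\<C>" "y \<in> \<Union>\<C>" for x y
      proof -
        obtain I1 I2 where *: "I1 \<in> \<C>" "I2 \<in> \<C>" "x \<in> I1" "y \<in> I2" using xy by blast
        then have "I1 \<subseteq> I2 \<or> I2 \<subseteq> I1" using C(2) by (auto simp: subset.chain_def)
        then show ?thesis using * I(1) ideal.subspace_add by blast
      qed
      show "c * x \<in> \<Union>\<C>" if "x \<in> \<Union>\<C>" for c x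
        using that I(1) ideal.subspace_scale by blast
    qed
    moreover have "J \<subseteq> \<Union>\<C>" "1 \<notin> \<Union>\<C>" using I C(1) by blast+
    ultimately show ?thesis by (simp add: \<A>_def)
  qed
  moreover have "\<A> \<noteq> {}" using J by (auto simp: \<A>_def)
  ultimately obtain M where M: "M \<in> \<A>" and max: "\<And>I. I \<in> \<A> \<Longrightarrow> M \<subseteq> I \<Longrightarrow> I = M"
    using subset_Zorn_nonempty[of \<A>] by metis
  have sM: "ideal.subspace M" "J \<subseteq> M" "1 \<notin> M" using M by (auto simp: \<A>_def)
  have "\<exists>b. a * b - 1 \<in> M" if "a \<notin> M" for a
  proof -
    have "M \<subseteq> ideal.span (insert a M)" "a \<in> ideal.span (insert a M)"
      using ideal.span_superset by blast+
    then have "ideal.span (insert a M) \<notin> \<A>" using max that by blast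
    then have "1 \<in> ideal.span (insert a M)"
      using \<open>M \<subseteq> ideal.span (insert a M)\<close> sM(2) by (auto simp: \<A>_def)
    then obtain k where "1 - k * a \<in> ideal.span M" by (auto simp: ideal.span_insert)
    then have "1 - k * a \<in> M" using sM(1) ideal.span_eq_iff by blast
    then have "-(1 - k * a) \<in> M" using ideal.subspace_neg sM(1) by blast
    then show ?thesis by (intro exI[of _ k]) (simp add: mult.commute)
  qed
  then have "maximal_ideal M" using sM by (auto simp: maximal_ideal_def)
  then show thesis using that sM by blast
qed

lemma maximal_ideal_prime:
  assumes M: "maximal_ideal M" and ab: "a * b \<in> M"
  shows "a \<in> M \<or> b \<in> M"
proof (rule ccontr)
  assume *: "\<not> ?thesis"
  have s: "ideal.subspace M" using M by (simp add: maximal_ideal_def)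
  from * M obtain c where c: "a * c - 1 \<in> M" by (auto simp: maximal_ideal_def)
  have "c * (a * b) \<in> M" "b * (a * c - 1) \<in> M"
    using s ab c ideal.subspace_scale by blast+
  then have "c * (a * b) - b * (a * c - 1) \<in> M" using s ideal.subspace_diff by blast
  moreover have "c * (a * b) - b * (a * c - 1) = b" by (simp add: right_diff_distrib ac_simps)
  ultimately show False using * by simp
qed

lemma maximal_ideal_power:
  assumes "maximal_ideal M" "a ^ n * b \<in> M" shows "a \<in> M \<or> b \<in> M"
  using assms(2)
proof (induction n)
  case (Suc n)
  then have "a * (a ^ n * b) \<in> M" by (simp add: mult.assoc)
  then show ?case using maximal_ideal_prime[OF assms(1)] Suc by blast
qed simp

text \<open>The kernel of the reduction of polynomials modulo \<open>m\<close>.\<close>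

definition poly_ideal :: "'a::comm_ring_1 set \<Rightarrow> 'a poly set" where
  "poly_ideal m = {p. \<forall>i. coeff p i \<in> m}"

lemma subspace_poly_ideal:
  assumes m: "ideal.subspace m" shows "ideal.subspace (poly_ideal m)"
proof (rule ideal.subspaceI)
  show "0 \<in> poly_ideal m" using m by (simp add: poly_ideal_def ideal.subspace_0)
  show "p + q \<in> poly_ideal m" if "p \<in> poly_ideal m" "q \<in> poly_ideal m" for p q
    using that m by (simp add: poly_ideal_def ideal.subspace_add)
  show "c * p \<in> poly_ideal m" if "p \<in> poly_ideal m" for c p
    using that m by (auto simp: poly_ideal_def coeff_mult intro!: ideal.subspace_sum ideal.subspace_scale)
qed

lemma monic_division:
  fixes g :: "'a::comm_ring_1 poly"
  assumes "lead_coeff g = 1"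
  obtains q r where "p = g * q + r" "r = 0 \<or> degree r < degree g"
proof -
  have g: "g \<noteq> 0" using assms by auto
  obtain q r where qr: "pseudo_divmod p g = (q, r)" by fastforce
  from pseudo_divmod[OF g qr] assms show thesis by (intro that[of q r]) auto
qed

text \<open>
  The index \<open>l\<close> is the degree of \<open>p\<close> modulo \<open>m\<close>.\<close>

lemma last_coeff_outside:
  assumes m: "ideal.subspace m" and p: "p \<notin> poly_ideal m"
  obtains l where "coeff p l \<notin> m" "l \<le> degree p" "\<And>i. i > l \<Longrightarrow> coeff p i \<in> m"
proof -
  define B where "B = {j. coeff p j \<notin> m}"
  have B: "B \<subseteq> {..degree p}"
  proof
    fix x assume "x \<in> B"
    then have "coeff p x \<noteq> 0" using ideal.subspace_0[OF m] by (auto simp: B_def)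
    then show "x \<in> {..degree p}" using le_degree by blast
  qed
  then have "finite B" by (rule finite_subset) auto
  moreover have "B \<noteq> {}" using p by (auto simp: B_def poly_ideal_def)
  ultimately have "Max B \<in> B" and max: "\<And>i. i \<in> B \<Longrightarrow> i \<le> Max B" by simp_all
  show thesis
  proof (rule that)
    show "coeff p (Max B) \<notin> m" using \<open>Max B \<in> B\<close> by (simp add: B_def)
    show "Max B \<le> degree p" using \<open>Max B \<in> B\<close> B by blast
    show "coeff p i \<in> m" if "i > Max B" for i using max[of i] that by (force simp: B_def)
  qed
qed

text \<open>
  Monic polynomials are not zero divisors modulo \<open>m\<close>: a top coefficient of \<open>p\<close> outside \<open>m\<close>
  would reappear as the top coefficient of \<open>h p\<close>.\<close>

lemma monic_mult_in_poly_ideal: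
  assumes m: "ideal.subspace m" and h: "lead_coeff h = 1" and hp: "h * p \<in> poly_ideal m"
  shows "p \<in> poly_ideal m"
proof (rule ccontr)
  assume "p \<notin> poly_ideal m"
  then obtain l where l: "coeff p l \<notin> m" and l': "\<And>i. i > l \<Longrightarrow> coeff p i \<in> m"
    using last_coeff_outside[OF m] by blast
  define n where "n = degree h + l"
  define S where "S = (\<Sum>i\<in>{..n} - {degree h}. coeff h i * coeff p (n - i))"
  have "coeff (h * p) n = (\<Sum>i\<le>n. coeff h i * coeff p (n - i))" by (simp add: coeff_mult)
  also have "\<dots> = coeff h (degree h) * coeff p (n - degree h) + S"
    unfolding S_def by (rule sum.remove) (auto simp: n_def)
  finally have "coeff p l = coeff (h * p) n - S" using h by (simp add: n_def)
  moreover have "S \<in> m"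
    unfolding S_def
  proof (rule ideal.subspace_sum[OF m])
    fix i assume i: "i \<in> {..n} - {degree h}"
    show "coeff h i * coeff p (n - i) \<in> m"
    proof (cases "i < degree h")
      case True
      then have "coeff p (n - i) \<in> m" by (intro l') (simp add: n_def)
      then show ?thesis by (rule ideal.subspace_scale[OF m])
    next
      case False
      then have "coeff h i = 0" using i by (intro coeff_eq_0) auto
      then show ?thesis using ideal.subspace_0[OF m] by simp
    qed
  qed
  moreover have "coeff (h * p) n \<in> m" using hp by (simp add: poly_ideal_def)
  ultimately show False using l ideal.subspace_diff[OF m] by simp
qed

text \<open>
  Polynomials over the residue field of \<open>m\<close> form a principal ideal domain. The generator is a
  monic element of least degree. A remainder that does not vanish modulo \<open>m\<close> would give a monic
  element of smaller degree, after discarding its top coefficients in \<open>m\<close> and dividing by the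
  first one that remains.\<close>

lemma ideal_mod_maximal_principal:
  fixes I :: "'a::comm_ring_1 poly set"
  assumes M: "maximal_ideal m" and I: "ideal.subspace I" "poly_ideal m \<subseteq> I"
    and f: "f \<in> I" "lead_coeff f = 1"
  obtains g where "g \<in> I" "lead_coeff g = 1" "\<And>p. p \<in> I \<Longrightarrow> \<exists>q. p - g * q \<in> poly_ideal m"
proof -
  have m: "ideal.subspace m" using M by (simp add: maximal_ideal_def)
  obtain g where g: "g \<in> I" "lead_coeff g = 1"
    and min: "\<And>p. p \<in> I \<Longrightarrow> lead_coeff p = 1 \<Longrightarrow> degree g \<le> degree p"
    using ex_has_least_nat[of "\<lambda>p. p \<in> I \<and> lead_coeff p = 1" f degree] f by auto
  have small: "r \<in> poly_ideal m" if r: "r \<in> I" "r = 0 \<or> degree r < degree g" for r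
  proof (rule ccontr)
    assume n: "r \<notin> poly_ideal m"
    then obtain l where l: "coeff r l \<notin> m" "l \<le> degree r" and l': "\<And>i. i > l \<Longrightarrow> coeff r i \<in> m"
      using last_coeff_outside[OF m] by blast
    from l M obtain b where b: "coeff r l * b - 1 \<in> m" by (auto simp: maximal_ideal_def)
    define s where "s = poly_cutoff l (smult b r) + monom 1 l"
    have "smult b r - s \<in> poly_ideal m"
      using l' b m by (auto simp: poly_ideal_def s_def coeff_poly_cutoff ideal.subspace_0
          ideal.subspace_scale mult.commute linorder_not_less)
    then have "smult b r - s \<in> I" using I by auto
    moreover have "smult b r \<in> I" using r(1) ideal.subspace_scale[OF I(1), of r "[:b:]"] by simp
    ultimately have "smult b r - (smult b r - s) \<in> I" using I(1) ideal.subspace_diff by blast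
    then have "s \<in> I" by simp
    have cl: "coeff s l = 1" by (simp add: s_def coeff_poly_cutoff)
    have "coeff s i = 0" if "i > l" for i using that by (simp add: s_def coeff_poly_cutoff)
    then have "degree s \<le> l" by (intro degree_le) auto
    moreover have "l \<le> degree s" using cl by (intro le_degree) auto
    ultimately have "degree s = l" by simp
    then have "degree g \<le> l" using min[OF \<open>s \<in> I\<close>] cl by simp
    moreover note l(2)
    moreover have "r \<noteq> 0" using n m subspace_poly_ideal ideal.subspace_0 by blast
    ultimately show False using r(2) by simp
  qed
  show thesis
  proof (rule that[OF g])
    fix p assume p: "p \<in> I"
    obtain q r where qr: "p = g * q + r" "r = 0 \<or> degree r < degree g"
      using monic_division[OF g(2)] by blast
    have "r \<in> I" using ideal.subspace_diff[OF I(1) p ideal_mult_right[OF I(1) g(1), of q]] qr(1)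
      by simp
    then show "\<exists>q. p - g * q \<in> poly_ideal m" using small qr by (intro exI[of _ q]) auto
  qed
qed

section \<open>Coprime combinations and elimination of the variable\<close>

text \<open>
  Over a field \<open>h\<close> would be the product of the primes that divide \<open>f\<close> but not \<open>g\<close>: then a prime divisor
  of \<open>f\<close> divides exactly one of \<open>g\<close> and \<open>h w\<close>. To avoid factorisations, \<open>d\<close> is taken
  as the greatest common divisor of \<open>f\<close> and \<open>g\<close>, and \<open>h\<close> as the part of \<open>f\<close> coprime to \<open>d\<close>,
  that is the generator of the ideal of all \<open>p\<close> for which \<open>f\<close> divides some \<open>d\<^sup>N p\<close>.\<close>

lemma choose_coprime_mod_maximal:
  fixes f g w :: "'a::comm_ring_1 poly"
  assumes M: "maximal_ideal m" and f: "lead_coeff f = 1"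
    and one: "1 \<in> ideal.span ({f, g, w} \<union> poly_ideal m)"
  obtains h where "1 \<in> ideal.span ({f, g + h * w} \<union> poly_ideal m)"
proof -
  let ?P = "poly_ideal m"
  let ?I = "ideal.span ({f, g} \<union> ?P)"
  let ?F = "ideal.span ({f} \<union> ?P)"
  have P: "ideal.subspace ?P" using M by (simp add: maximal_ideal_def subspace_poly_ideal)
  have sub: "ideal.span A \<subseteq> Q" if "A \<subseteq> Q" "ideal.subspace Q" for A Q :: "'a poly set"
    using that by (rule ideal.span_minimal)
  have fI: "?P \<subseteq> ?I" "f \<in> ?I" using ideal.span_superset[of "{f, g} \<union> ?P"] by auto
  obtain d where d: "d \<in> ?I" "lead_coeff d = 1" and d_gen: "\<And>p. p \<in> ?I \<Longrightarrow> \<exists>q. p - d * q \<in> ?P"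
    by (rule ideal_mod_maximal_principal[OF M ideal.subspace_span fI f]) blast
  define H where "H = {p. \<exists>N. d ^ N * p \<in> ?F}"
  have "ideal.subspace H"
  proof (rule ideal.subspaceI)
    show "0 \<in> H" by (simp add: H_def ideal.span_zero)
    show "p + q \<in> H" if pq: "p \<in> H" "q \<in> H" for p q
    proof -
      obtain N K where "d ^ N * p \<in> ?F" "d ^ K * q \<in> ?F" using pq by (auto simp: H_def)
      then have "d ^ K * (d ^ N * p) + d ^ N * (d ^ K * q) \<in> ?F"
        by (rule ideal.span_add[OF ideal.span_scale ideal.span_scale])
      then have "d ^ (N + K) * (p + q) \<in> ?F" by (simp add: power_add algebra_simps)
      then show ?thesis by (auto simp: H_def)
    qed
    show "c * p \<in> H" if p: "p \<in> H" for c p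
    proof -
      obtain N where "d ^ N * p \<in> ?F" using p by (auto simp: H_def)
      then have "c * (d ^ N * p) \<in> ?F" by (rule ideal.span_scale)
      then have "d ^ N * (c * p) \<in> ?F" by (simp add: ac_simps)
      then show ?thesis by (auto simp: H_def)
    qed
  qed
  moreover have "?F \<subseteq> H"
  proof
    fix p assume "p \<in> ?F"
    then have "d ^ 0 * p \<in> ?F" by simp
    then show "p \<in> H" unfolding H_def by blast
  qed
  moreover have PF: "?P \<subseteq> ?F" and "f \<in> ?F" using ideal.span_superset[of "{f} \<union> ?P"] by auto
  ultimately have H: "ideal.subspace H" "?P \<subseteq> H" "f \<in> H" by auto
  obtain h where h: "h \<in> H" "lead_coeff h = 1" and h_gen: "\<And>p. p \<in> H \<Longrightarrow> \<exists>q. p - h * q \<in> ?P"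
    by (rule ideal_mod_maximal_principal[OF M H f]) blast
  obtain N where N: "d ^ N * h \<in> ?F" using h(1) by (auto simp: H_def)
  let ?K = "ideal.span ({d, h} \<union> ?P)"
  \<comment> \<open>A common divisor \<open>e\<close> of \<open>d\<close> and \<open>h\<close> could be cancelled from \<open>h\<close> inside \<open>H\<close>, so it is a unit.\<close>
  have K: "1 \<in> ?K"
  proof -
    have dhK: "d \<in> ?K" "h \<in> ?K" "?P \<subseteq> ?K" using ideal.span_superset[of "{d, h} \<union> ?P"] by auto
    obtain e where e: "e \<in> ?K" "lead_coeff e = 1" and e_gen: "\<And>p. p \<in> ?K \<Longrightarrow> \<exists>q. p - e * q \<in> ?P"
      by (rule ideal_mod_maximal_principal[OF M ideal.subspace_span dhK(3,1) d(2)]) blast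
    obtain d1 h1 where d1: "d - e * d1 \<in> ?P" and h1: "h - e * h1 \<in> ?P"
      using e_gen dhK by blast
    have "d ^ N * (h1 * (d - e * d1) - d1 * (h - e * h1)) \<in> ?F"
      by (rule ideal.span_scale, rule ideal.span_diff; rule ideal.span_scale) (use d1 h1 PF in blast)+
    moreover have "d1 * (d ^ N * h) \<in> ?F" using N by (rule ideal.span_scale)
    ultimately have "d ^ N * (h1 * (d - e * d1) - d1 * (h - e * h1)) + d1 * (d ^ N * h) \<in> ?F"
      by (rule ideal.span_add)
    moreover have "d ^ N * (h1 * (d - e * d1) - d1 * (h - e * h1)) + d1 * (d ^ N * h) = d ^ Suc N * h1"
      by (simp add: right_diff_distrib ac_simps)
    ultimately have "d ^ Suc N * h1 \<in> ?F" by simp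
    then have "h1 \<in> H" unfolding H_def by blast
    then obtain h2 where h2: "h1 - h * h2 \<in> ?P" using h_gen by blast
    have "(h - e * h1) + e * (h1 - h * h2) \<in> ?P"
      using h1 h2 P by (intro ideal.subspace_add ideal.subspace_scale)
    moreover have "(h - e * h1) + e * (h1 - h * h2) = h * (1 - e * h2)"
      by (simp add: right_diff_distrib ac_simps)
    ultimately have "1 - e * h2 \<in> ?P"
      using monic_mult_in_poly_ideal h(2) M by (metis maximal_ideal_def)
    then have "(1 - e * h2) + h2 * e \<in> ?K" using e(1) dhK(3)
      by (intro ideal.span_add ideal.span_scale) auto
    then show ?thesis by (simp add: ac_simps)
  qed
  \<comment> \<open>Otherwise a maximal ideal \<open>Q\<close> contains \<open>f\<close> and \<open>g + h w\<close>, hence exactly one of \<open>d\<close> and \<open>h\<close>, and neither case is possible.\<close>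
  have "1 \<in> ideal.span ({f, g + h * w} \<union> ?P)"
  proof (rule ccontr)
    assume n: "1 \<notin> ideal.span ({f, g + h * w} \<union> ?P)"
    obtain Q where Q: "maximal_ideal Q" "ideal.span ({f, g + h * w} \<union> ?P) \<subseteq> Q"
      using maximal_ideal_exists[OF ideal.subspace_span n] by blast
    have sQ: "ideal.subspace Q" "1 \<notin> Q" using Q(1) by (auto simp: maximal_ideal_def)
    have in_Q: "f \<in> Q" "g + h * w \<in> Q" "?P \<subseteq> Q"
      using Q(2) ideal.span_superset[of "{f, g + h * w} \<union> ?P"] by auto
    have not_both: "\<not> (d \<in> Q \<and> h \<in> Q)"
      using sub[of "{d, h} \<union> ?P" Q] sQ in_Q K by auto
    have "?F \<subseteq> Q" using in_Q sQ by (intro sub) auto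
    then have "d \<in> Q \<or> h \<in> Q" using N maximal_ideal_power[OF Q(1)] by blast
    moreover have "d \<in> Q" if "h \<in> Q"
    proof -
      have "(g + h * w) - w * h \<in> Q"
        using that in_Q sQ by (intro ideal.subspace_diff ideal.subspace_scale)
      then have "g \<in> Q" by (simp add: ac_simps)
      then have "?I \<subseteq> Q" using in_Q sQ by (intro sub) auto
      then show ?thesis using d(1) by blast
    qed
    ultimately have d_in: "d \<in> Q" and h_notin: "h \<notin> Q" using not_both by blast+
    have "g \<in> ?I" using ideal.span_superset[of "{f, g} \<union> ?P"] by auto
    then obtain q where q: "g - d * q \<in> ?P" using d_gen by blast
    then have "(g - d * q) + q * d \<in> Q"
      using in_Q d_in sQ by (intro ideal.subspace_add ideal.subspace_scale) auto
    then have g_in: "g \<in> Q" by (simp add: ac_simps)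
    then have "(g + h * w) - g \<in> Q" using in_Q sQ by (intro ideal.subspace_diff)
    then have "h * w \<in> Q" by simp
    then have "w \<in> Q" using maximal_ideal_prime[OF Q(1)] h_notin by blast
    then have "ideal.span ({f, g, w} \<union> ?P) \<subseteq> Q" using in_Q sQ g_in by (intro sub) auto
    then show False using one sQ by blast
  qed
  then show thesis by (rule that)
qed

text \<open>
  This is Nakayama's lemma for the algebra of polynomials modulo \<open>I\<close>, which is generated as a module
  by \<open>1, x, \<dots>, x\<^sup>n\<^sup>-\<^sup>1\<close> because \<open>I\<close> has a monic element of degree \<open>n\<close>. The generators are eliminated
  one at a time from the top: each is a combination of the lower ones and of itself with a
  coefficient in \<open>m\<close>, after multiplication by some \<open>c\<close> congruent to \<open>1\<close>.\<close>

lemma constant_in_ideal_mod: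
  fixes I :: "'a::comm_ring_1 poly set"
  assumes m: "ideal.subspace m" and I: "ideal.subspace I" and f: "f \<in> I" "lead_coeff f = 1"
    and p0: "p0 \<in> I" "1 - p0 \<in> poly_ideal m"
  obtains c where "1 - c \<in> m" "[:c:] \<in> I"
proof -
  have smult_I: "smult a p \<in> I" if "p \<in> I" for a p
    using ideal.subspace_scale[OF I that, of "[:a:]"] by simp
  have "j \<le> degree f \<Longrightarrow> \<exists>c. 1 - c \<in> m \<and> (\<forall>p. \<exists>q. (\<forall>i\<ge>j. coeff q i = 0) \<and> smult c p - q \<in> I)" for j
  proof (induction rule: inc_induct)
    case base
    have "\<exists>q. (\<forall>i\<ge>degree f. coeff q i = 0) \<and> smult 1 p - q \<in> I" for p
    proof -
      obtain q r where qr: "p = f * q + r" "r = 0 \<or> degree r < degree f"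
        using monic_division[OF f(2)] by blast
      have "f * q \<in> I" by (rule ideal_mult_right[OF I f(1)])
      moreover have "\<forall>i\<ge>degree f. coeff r i = 0" using qr(2) by (auto intro: coeff_eq_0)
      ultimately show ?thesis using qr(1) by (intro exI[of _ r]) simp
    qed
    then show ?case using ideal.subspace_0[OF m] by (intro exI[of _ 1]) simp
  next
    case (step j)
    then obtain c where c: "1 - c \<in> m"
      and "\<forall>p. \<exists>q. (\<forall>i\<ge>Suc j. coeff q i = 0) \<and> smult c p - q \<in> I" by blast
    then obtain Q where Q: "\<And>p i. i \<ge> Suc j \<Longrightarrow> coeff (Q p) i = 0" "\<And>p. smult c p - Q p \<in> I"
      by metis
    define \<mu> where "\<mu> = monom 1 j * (1 - p0)"
    have \<mu>: "\<mu> \<in> poly_ideal m"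
      unfolding \<mu>_def using subspace_poly_ideal[OF m] p0(2) by (rule ideal.subspace_scale)
    define q where "q = (\<Sum>i\<le>degree \<mu>. smult (coeff \<mu> i) (Q (monom 1 i)))"
    have q_m: "coeff q i \<in> m" for i
      unfolding q_def coeff_sum coeff_smult using \<mu> m
      by (intro ideal.subspace_sum ideal_mult_right) (auto simp: poly_ideal_def)
    have q_0: "coeff q i = 0" if "i \<ge> Suc j" for i
      using that by (simp add: q_def coeff_sum Q(1))
    have "(\<Sum>i\<le>degree \<mu>. smult (coeff \<mu> i) (smult c (monom 1 i) - Q (monom 1 i))) \<in> I"
      using Q(2) I smult_I by (intro ideal.subspace_sum) auto
    also have "(\<Sum>i\<le>degree \<mu>. smult (coeff \<mu> i) (smult c (monom 1 i) - Q (monom 1 i)))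
        = (\<Sum>i\<le>degree \<mu>. [:c:] * monom (coeff \<mu> i) i - smult (coeff \<mu> i) (Q (monom 1 i)))"
      by (intro sum.cong refl) (simp add: smult_diff_right smult_monom mult.commute)
    also have "\<dots> = [:c:] * (\<Sum>i\<le>degree \<mu>. monom (coeff \<mu> i) i) - q"
      by (simp only: q_def sum_subtractf sum_distrib_left)
    also have "\<dots> = smult c \<mu> - q" by (simp add: poly_as_sum_of_monoms)
    finally have \<mu>q: "smult c \<mu> - q \<in> I" .
    define m' where "m' = coeff q j"
    define q' where "q' = q - monom m' j"
    have q': "coeff q' i = 0" if "i \<ge> j" for i
      using that q_0[of i] by (cases "i = j") (auto simp: q'_def m'_def)
    have "smult c (monom 1 j * p0) + (smult c \<mu> - q) \<in> I"
      using \<mu>q p0(1) I smult_I by (intro ideal.subspace_add ideal.subspace_scale) (auto intro: ideal.subspace_scale)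
    moreover have "smult c (monom 1 j * p0) + (smult c \<mu> - q) = monom (c - m') j - q'"
      by (simp add: \<mu>_def q'_def right_diff_distrib smult_diff_right smult_monom diff_monom[symmetric])
    ultimately have key: "monom (c - m') j - q' \<in> I" by simp
    have "1 - c * (c - m') \<in> m"
    proof -
      have "(1 - c) + (c * (1 - c) + c * m') \<in> m"
        using c q_m m by (auto simp: m'_def intro!: ideal.subspace_add ideal.subspace_scale)
      then show ?thesis by (simp add: algebra_simps)
    qed
    moreover have "\<exists>q. (\<forall>i\<ge>j. coeff q i = 0) \<and> smult (c * (c - m')) p - q \<in> I" for p
    proof -
      define a where "a = coeff (Q p) j"
      define r where "r = Q p - monom a j"
      have r: "coeff r i = 0" if "i \<ge> j" for i
        using that Q(1)[of i p] by (cases "i = j") (auto simp: r_def a_def)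
      have "smult (c - m') (smult c p - Q p) + smult a (monom (c - m') j - q') \<in> I"
        using key Q(2) smult_I I by (intro ideal.subspace_add) auto
      moreover have "smult (c - m') (smult c p - Q p) + smult a (monom (c - m') j - q')
          = smult (c * (c - m')) p - (smult (c - m') r + smult a q')"
        by (simp add: r_def smult_diff_right smult_monom mult.commute)
      ultimately show ?thesis using r q' by (intro exI[of _ "smult (c - m') r + smult a q'"]) simp
    qed
    ultimately show ?case by blast
  qed
  from this[of 0] obtain c where c: "1 - c \<in> m"
    and "\<forall>p. \<exists>q. (\<forall>i. coeff q i = 0) \<and> smult c p - q \<in> I" by auto
  then obtain q where "\<And>i. coeff q i = 0" "smult c 1 - q \<in> I" by blast
  then have "[:c:] \<in> I" using poly_eqI[of q 0] by (simp add: one_pCons)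
  with c show thesis by (rule that)
qed

section \<open>Unimodular rows and the theorem of Suslin\<close>

text \<open>
  Only the pairs of coordinates that contain the first one are used, since these are the moves that
  lift easily to Zorn's algebra; the lemmas below recover the elementary operations on the other
  pairs as commutators. The parameter \<open>S\<close> is the subring from which the coefficients come.\<close>

inductive sl2_step :: "'a::comm_ring_1 set \<Rightarrow> 'a \<times> 'a \<times> 'a \<times> 'a \<Rightarrow> 'a \<times> 'a \<times> 'a \<times> 'a \<Rightarrow> bool"
  for S where
  sl2_12: "\<lbrakk>{a, b, c, d} \<subseteq> S; a * d - b * c = 1\<rbrakk> \<Longrightarrow>
    sl2_step S (x, y, z, w) (a * x + b * y, c * x + d * y, z, w)"
| sl2_13: "\<lbrakk>{a, b, c, d} \<subseteq> S; a * d - b * c = 1\<rbrakk> \<Longrightarrow>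
    sl2_step S (x, y, z, w) (a * x + b * z, y, c * x + d * z, w)"
| sl2_14: "\<lbrakk>{a, b, c, d} \<subseteq> S; a * d - b * c = 1\<rbrakk> \<Longrightarrow>
    sl2_step S (x, y, z, w) (a * x + b * w, y, z, c * x + d * w)"

abbreviation sl2_equiv :: "'a::comm_ring_1 set \<Rightarrow> 'a \<times> 'a \<times> 'a \<times> 'a \<Rightarrow> 'a \<times> 'a \<times> 'a \<times> 'a \<Rightarrow> bool" where
  "sl2_equiv S \<equiv> (sl2_step S)\<^sup>*\<^sup>*"

lemma sl2_equiv_12:
  "a * d - b * c = 1 \<Longrightarrow> sl2_equiv UNIV (x, y, z, w) (a * x + b * y, c * x + d * y, z, w)"
  by (intro r_into_rtranclp sl2_12) auto

lemma sl2_equiv_13: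
  "a * d - b * c = 1 \<Longrightarrow> sl2_equiv UNIV (x, y, z, w) (a * x + b * z, y, c * x + d * z, w)"
  by (intro r_into_rtranclp sl2_13) auto

lemma sl2_equiv_14:
  "a * d - b * c = 1 \<Longrightarrow> sl2_equiv UNIV (x, y, z, w) (a * x + b * w, y, z, c * x + d * w)"
  by (intro r_into_rtranclp sl2_14) auto

lemma sl2_equiv_add_first:
  "sl2_equiv UNIV (x, y, z, w) (x, y + r * x, z + s * x, w + t * x)"
proof -
  have "sl2_equiv UNIV (x, y, z, w) (x, y + r * x, z, w)"
    using sl2_equiv_12[of 1 1 0 r x y z w] by (simp add: add.commute)
  also have "sl2_equiv UNIV \<dots> (x, y + r * x, z + s * x, w)"
    using sl2_equiv_13[of 1 1 0 s x "y + r * x" z w] by (simp add: add.commute)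
  also have "sl2_equiv UNIV \<dots> (x, y + r * x, z + s * x, w + t * x)"
    using sl2_equiv_14[of 1 1 0 t x "y + r * x" "z + s * x" w] by (simp add: add.commute)
  finally show ?thesis .
qed

lemma sl2_equiv_add_to_first:
  "sl2_equiv UNIV (x, y, z, w) (x + r * y + s * z + t * w, y, z, w)"
proof -
  have "sl2_equiv UNIV (x, y, z, w) (x + r * y, y, z, w)"
    using sl2_equiv_12[of 1 1 r 0 x y z w] by simp
  also have "sl2_equiv UNIV \<dots> (x + r * y + s * z, y, z, w)"
    using sl2_equiv_13[of 1 1 s 0 "x + r * y" y z w] by simp
  also have "sl2_equiv UNIV \<dots> (x + r * y + s * z + t * w, y, z, w)"
    using sl2_equiv_14[of 1 1 t 0 "x + r * y + s * z" y z w] by simp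
  finally show ?thesis .
qed

lemma sl2_equiv_add_second:
  "sl2_equiv UNIV (x, y, z, w) (x, y, z + s * y, w + t * y)"
proof -
  have "sl2_equiv UNIV (x, y, z, w) (x + y, y, z, w)"
    using sl2_equiv_add_to_first[of x y z w 1 0 0] by simp
  also have "sl2_equiv UNIV \<dots> (x + y, y, z + s * (x + y), w + t * (x + y))"
    using sl2_equiv_add_first[of "x + y" y z w 0 s t] by simp
  also have "sl2_equiv UNIV \<dots> (x, y, z + s * (x + y), w + t * (x + y))"
    using sl2_equiv_add_to_first[of "x + y" y "z + s * (x + y)" "w + t * (x + y)" "-1" 0 0] by simp
  also have "sl2_equiv UNIV \<dots> (x, y, z + s * y, w + t * y)"
    using sl2_equiv_add_first[of x y "z + s * (x + y)" "w + t * (x + y)" 0 "-s" "-t"]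
    by (simp add: algebra_simps)
  finally show ?thesis .
qed

lemma sl2_equiv_add_to_second:
  "sl2_equiv UNIV (x, y, z, w) (x, y + s * z + t * w, z, w)"
proof -
  have "sl2_equiv UNIV (x, y, z, w) (x + s * z + t * w, y, z, w)"
    using sl2_equiv_add_to_first[of x y z w 0 s t] by simp
  also have "sl2_equiv UNIV \<dots> (x + s * z + t * w, y + (x + s * z + t * w), z, w)"
    using sl2_equiv_add_first[of "x + s * z + t * w" y z w 1 0 0] by simp
  also have "sl2_equiv UNIV \<dots> (x, y + (x + s * z + t * w), z, w)"
    using sl2_equiv_add_to_first[of "x + s * z + t * w" "y + (x + s * z + t * w)" z w 0 "-s" "-t"] by simp
  also have "sl2_equiv UNIV \<dots> (x, y + s * z + t * w, z, w)"
    using sl2_equiv_add_first[of x "y + (x + s * z + t * w)" z w "-1" 0 0]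
    by (simp add: algebra_simps)
  finally show ?thesis .
qed

lemma poly_at_translate:
  fixes f :: "'a::comm_ring_1 poly"
  shows "poly f (b + e) = poly f b + e * poly (synthetic_div f b) (b + e)"
proof -
  have "poly ([:- b, 1:] * synthetic_div f b + [:poly f b:]) (b + e) = poly f (b + e)"
    by (simp only: synthetic_div_correct')
  then show ?thesis by (simp add: algebra_simps)
qed

text \<open>
  On the first two coordinates the move is given by an explicit matrix. With
  \<open>f\<^sub>i (b + cd) = f\<^sub>i (b) + c d s\<^sub>i\<close>, the matrix \<open>1 + d s g\<^sup>T\<close> has the right effect because
  \<open>g\<^sup>T f (b) = c\<close>. Its determinant is corrected to \<open>1\<close> by adding a multiple of the row
  \<open>(- f\<^sub>2 (b), f\<^sub>1 (b))\<close>, which annihilates \<open>f (b)\<close>, and the identity that makes this work is \<open>rel\<close>. The other coordinates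
  change by multiples of \<open>c\<close>, which lies in the ideal generated by the first two.\<close>

lemma sl2_equiv_poly_translate:
  fixes f1 f2 f3 f4 :: "'a::comm_ring_1 poly"
  assumes c: "g1 * f1 + g2 * f2 = [:c:]"
  shows "sl2_equiv UNIV (poly f1 b, poly f2 b, poly f3 b, poly f4 b)
    (poly f1 (b + c * d), poly f2 (b + c * d), poly f3 (b + c * d), poly f4 (b + c * d))"
proof -
  define e where "e = c * d"
  define s where "s f = poly (synthetic_div f b) (b + e)" for f :: "'a poly"
  define x y p q where "x = poly f1 b" and "y = poly f2 b" and "p = poly g1 b" and "q = poly g2 b"
  have tr: "poly f (b + e) = poly f b + e * s f" for f
    unfolding s_def by (rule poly_at_translate)
  have pq: "p * x + q * y = c"
    using arg_cong[OF c, of "\<lambda>f. poly f b"] by (simp add: x_def y_def p_def q_def)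
  \<comment> \<open>This expresses that \<open>g\<^sub>1 f\<^sub>1 + g\<^sub>2 f\<^sub>2\<close> is constant. As \<open>c d\<close> may be a zero divisor, the cancellation is done before evaluating, where the factor is \<open>x - b\<close>.\<close>
  have rel: "p * s f1 + q * s f2 + s g1 * x + s g2 * y + e * (s g1 * s f1 + s g2 * s f2) = 0"
  proof -
    let ?L = "[:- b, 1:]" and ?s = "\<lambda>f. synthetic_div f b"
    define z where "z = [:p:] * ?s f1 + [:q:] * ?s f2 + ?s g1 * [:x:] + ?s g2 * [:y:]
      + ?L * (?s g1 * ?s f1 + ?s g2 * ?s f2)"
    have expand: "(L * a + p) * (L * c + x) + (L * a' + q) * (L * c' + y)
      = L * (p * c + q * c' + a * x + a' * y + L * (a * c + a' * c')) + (p * x + q * y)"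
      for L a a' c c' p q x y :: "'a poly"
      by (simp add: algebra_simps)
    have split: "f = ?L * ?s f + [:poly f b:]" for f :: "'a poly"
      by (simp only: synthetic_div_correct')
    have "[:c:] = (?L * ?s g1 + [:p:]) * (?L * ?s f1 + [:x:]) + (?L * ?s g2 + [:q:]) * (?L * ?s f2 + [:y:])"
      unfolding p_def q_def x_def y_def using c by (simp only: split[symmetric])
    also have "\<dots> = ?L * z + ([:p:] * [:x:] + [:q:] * [:y:])"
      unfolding z_def by (rule expand)
    also have "[:p:] * [:x:] + [:q:] * [:y:] = [:c:]" using pq by (simp add: mult.commute)
    finally have "?L * z = 0" by simp
    then have "z \<in> poly_ideal {0}"
      using monic_mult_in_poly_ideal[OF ideal.subspace_single_0, of ?L z] by (simp add: poly_ideal_def)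
    then have "z = 0" by (intro poly_eqI) (simp add: poly_ideal_def)
    then have "poly z (b + e) = 0" by simp
    then show ?thesis by (simp add: z_def s_def algebra_simps)
  qed
  define k where "k = s g1"
  define l where "l = s g2"
  let ?A = "1 + d * s f1 * p + d * l * y" and ?B = "d * s f1 * q - d * l * x"
  let ?C = "d * s f2 * p - d * k * y" and ?D = "1 + d * s f2 * q + d * k * x"
  have "?A * ?D - ?B * ?C = 1 + d * (p * s f1 + q * s f2 + k * x + l * y
     + d * (p * x + q * y) * (k * s f1 + l * s f2))"
    by (simp add: algebra_simps)
  also have "\<dots> = 1" using rel by (simp add: pq e_def k_def l_def mult.commute)
  finally have det: "?A * ?D - ?B * ?C = 1" .
  define x' y' where "x' = poly f1 (b + e)" and "y' = poly f2 (b + e)"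
  have "?A * x + ?B * y = x + d * s f1 * (p * x + q * y)" by (simp add: algebra_simps)
  also have "\<dots> = x'" unfolding pq x'_def tr by (simp add: x_def e_def ac_simps)
  finally have x': "?A * x + ?B * y = x'" .
  have "?C * x + ?D * y = y + d * s f2 * (p * x + q * y)" by (simp add: algebra_simps)
  also have "\<dots> = y'" unfolding pq y'_def tr by (simp add: y_def e_def ac_simps)
  finally have y': "?C * x + ?D * y = y'" .
  define p' q' where "p' = poly g1 (b + e)" and "q' = poly g2 (b + e)"
  have pq': "p' * x' + q' * y' = c"
    using arg_cong[OF c, of "\<lambda>f. poly f (b + e)"] by (simp add: x'_def y'_def p'_def q'_def)
  have shift: "poly f b + d * s f * p' * x' + d * s f * q' * y' = poly f (b + e)" for f
  proof -
    have "poly f b + d * s f * p' * x' + d * s f * q' * y' = poly f b + d * s f * (p' * x' + q' * y')"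
      by (simp add: distrib_left mult.assoc)
    also have "\<dots> = poly f (b + e)" unfolding pq' tr by (simp add: e_def ac_simps)
    finally show ?thesis .
  qed
  have "sl2_equiv UNIV (x, y, poly f3 b, poly f4 b) (x', y', poly f3 b, poly f4 b)"
    using sl2_equiv_12[OF det, of x y "poly f3 b" "poly f4 b"] by (simp only: x' y')
  also have "sl2_equiv UNIV \<dots> (x', y', poly f3 b + d * s f3 * p' * x', poly f4 b + d * s f4 * p' * x')"
    using sl2_equiv_add_first[of x' y' _ _ 0] by simp
  also have "sl2_equiv UNIV \<dots> (x', y', poly f3 (b + e), poly f4 (b + e))"
    using sl2_equiv_add_second[of x' y' "poly f3 b + d * s f3 * p' * x'" "poly f4 b + d * s f4 * p' * x'"
        "d * s f3 * q'" "d * s f4 * q'"] by (simp only: shift)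
  finally show ?thesis by (simp only: x_def y_def x'_def y'_def e_def)
qed

text \<open>
  The \<open>c\<close> for which the class of the row depends on the point only modulo \<open>c\<close> form an ideal \<open>J\<close>.
  If it were contained in a maximal ideal \<open>m\<close>, one could add multiples of the last two entries to the second one to
  make the first two coprime modulo \<open>m\<close>. By Nakayama's lemma their ideal would then contain a
  constant \<open>c\<close> congruent to \<open>1\<close> modulo \<open>m\<close>, and this \<open>c\<close> lies in \<open>J\<close>.\<close>

theorem sl2_equiv_poly_eval:
  fixes f1 f2 f3 f4 :: "'a::comm_ring_1 poly"
  assumes monic: "lead_coeff f1 = 1" and um: "u1 * f1 + u2 * f2 + u3 * f3 + u4 * f4 = 1"
  shows "sl2_equiv UNIV (poly f1 b, poly f2 b, poly f3 b, poly f4 b)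
    (poly f1 b', poly f2 b', poly f3 b', poly f4 b')"
proof -
  define row where "row b = (poly f1 b, poly f2 b, poly f3 b, poly f4 b)" for b
  define J where "J = {c. \<forall>b d. sl2_equiv UNIV (row b) (row (b + c * d))}"
  have J: "ideal.subspace J"
  proof (rule ideal.subspaceI)
    show "0 \<in> J" by (simp add: J_def)
    show "x + y \<in> J" if "x \<in> J" "y \<in> J" for x y
      unfolding J_def
    proof (intro CollectI allI)
      fix b d
      have "sl2_equiv UNIV (row b) (row (b + x * d))" using that by (simp add: J_def)
      also have "sl2_equiv UNIV \<dots> (row (b + x * d + y * d))" using that by (simp add: J_def)
      finally show "sl2_equiv UNIV (row b) (row (b + (x + y) * d))" by (simp add: algebra_simps)
    qed
    show "c * x \<in> J" if "x \<in> J" for c x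
      unfolding J_def
    proof (intro CollectI allI)
      fix b d
      have "sl2_equiv UNIV (row b) (row (b + x * (c * d)))" using that by (simp add: J_def)
      then show "sl2_equiv UNIV (row b) (row (b + c * x * d))" by (simp add: ac_simps)
    qed
  qed
  have "1 \<in> J"
  proof (rule ccontr)
    assume "1 \<notin> J"
    then obtain m where M: "maximal_ideal m" and Jm: "J \<subseteq> m" using maximal_ideal_exists[OF J] by blast
    have m: "ideal.subspace m" "1 \<notin> m" using M by (auto simp: maximal_ideal_def)
    have P: "ideal.subspace (poly_ideal m)" using m by (intro subspace_poly_ideal)
    define w where "w = u3 * f3 + u4 * f4"
    have "{f1, f2, w} \<subseteq> ideal.span ({f1, f2, w} \<union> poly_ideal m)"
      using ideal.span_superset[of "{f1, f2, w} \<union> poly_ideal m"] by simp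
    then have "u1 * f1 + u2 * f2 + w \<in> ideal.span ({f1, f2, w} \<union> poly_ideal m)"
      by (intro ideal.span_add ideal.span_scale) auto
    then have "1 \<in> ideal.span ({f1, f2, w} \<union> poly_ideal m)" using um by (simp add: w_def add.assoc)
    then obtain h where h: "1 \<in> ideal.span ({f1, f2 + h * w} \<union> poly_ideal m)"
      using choose_coprime_mod_maximal[OF M monic] by blast
    define F where "F = f2 + h * w"
    have "1 \<in> ideal.span (insert f1 (insert F (poly_ideal m)))" using h by (simp add: F_def)
    then obtain k l where kl: "1 - k * f1 - l * F \<in> poly_ideal m"
      using P by (metis ideal.span_breakdown_eq ideal.span_eq_iff)
    let ?I = "ideal.span {f1, F}"
    have "f1 \<in> ?I" "F \<in> ?I" by (simp_all add: ideal.span_base)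
    then have "k * f1 + l * F \<in> ?I" by (intro ideal.span_add ideal.span_scale)
    then obtain c where c: "1 - c \<in> m" "[:c:] \<in> ?I"
      using constant_in_ideal_mod[OF m(1) ideal.subspace_span \<open>f1 \<in> ?I\<close> monic, of "k * f1 + l * F"] kl
      by (auto simp: diff_diff_eq)
    obtain g1 g2 where g: "g1 * f1 + g2 * F = [:c:]"
    proof -
      obtain g1 where "[:c:] - g1 * f1 \<in> ideal.span {F}" using c(2) ideal.span_breakdown_eq by blast
      then obtain g2 where "[:c:] - g1 * f1 = g2 * F" by (auto simp: ideal.span_singleton)
      then show thesis by (intro that[of g1 g2]) (simp add: algebra_simps)
    qed
    have F: "poly F b = poly f2 b + poly (h * u3) b * poly f3 b + poly (h * u4) b * poly f4 b" for b
      by (simp add: F_def w_def algebra_simps)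
    have "sl2_equiv UNIV (row b) (row (b + c * d))" for b d
    proof -
      let ?b = "b + c * d"
      have "sl2_equiv UNIV (row b) (poly f1 b, poly F b, poly f3 b, poly f4 b)"
        unfolding row_def F by (rule sl2_equiv_add_to_second)
      also have "sl2_equiv UNIV \<dots> (poly f1 ?b, poly F ?b, poly f3 ?b, poly f4 ?b)"
        by (rule sl2_equiv_poly_translate[OF g])
      also have "sl2_equiv UNIV \<dots> (row ?b)"
        using sl2_equiv_add_to_second[of "poly f1 ?b" "poly F ?b" "poly f3 ?b" "poly f4 ?b"
            "- poly (h * u3) ?b" "- poly (h * u4) ?b"] by (simp only: F row_def) (simp add: algebra_simps)
      finally show ?thesis .
    qed
    then have "c \<in> J" by (simp add: J_def)
    then have "(1 - c) + c \<in> m" using c(1) Jm m(1) by (intro ideal.subspace_add) auto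
    then show False using m(2) by simp
  qed
  then have "sl2_equiv UNIV (row b) (row (b + 1 * (b' - b)))" unfolding J_def by blast
  moreover have "b + 1 * (b' - b) = b'" by simp
  ultimately show ?thesis by (simp only: row_def)
qed

section \<open>Zorn's algebra and the spin representation\<close>

\<comment> \<open>Quantifiers over vector matrices are kept whole; they are split into coordinates only where an identity is expanded.\<close>
declare split_paired_All [simp del] split_paired_Ex [simp del]

fun zmul :: "'a::comm_ring_1 zorn_matrix \<Rightarrow> 'a zorn_matrix \<Rightarrow> 'a zorn_matrix" where
  "zmul (a, (u1, u2, u3), (v1, v2, v3), b) (a', (u1', u2', u3'), (v1', v2', v3'), b') =
    (a * a' + (u1 * v1' + u2 * v2' + u3 * v3'),
     (a * u1' + b' * u1 - (v2 * v3' - v3 * v2'),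
      a * u2' + b' * u2 - (v3 * v1' - v1 * v3'),
      a * u3' + b' * u3 - (v1 * v2' - v2 * v1')),
     (a' * v1 + b * v1' + (u2 * u3' - u3 * u2'),
      a' * v2 + b * v2' + (u3 * u1' - u1 * u3'),
      a' * v3 + b * v3' + (u1 * u2' - u2 * u1')),
     b * b' + (v1 * u1' + v2 * u2' + v3 * u3'))"

fun zadd :: "'a::comm_ring_1 zorn_matrix \<Rightarrow> 'a zorn_matrix \<Rightarrow> 'a zorn_matrix" where
  "zadd (a, (u1, u2, u3), (v1, v2, v3), b) (a', (u1', u2', u3'), (v1', v2', v3'), b') =
    (a + a', (u1 + u1', u2 + u2', u3 + u3'), (v1 + v1', v2 + v2', v3 + v3'), b + b')"

fun zscale :: "'a::comm_ring_1 \<Rightarrow> 'a zorn_matrix \<Rightarrow> 'a zorn_matrix" where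
  "zscale r (a, (u1, u2, u3), (v1, v2, v3), b) =
    (r * a, (r * u1, r * u2, r * u3), (r * v1, r * v2, r * v3), r * b)"

fun znorm :: "'a::comm_ring_1 zorn_matrix \<Rightarrow> 'a" where
  "znorm (a, (u1, u2, u3), (v1, v2, v3), b) = a * b - (u1 * v1 + u2 * v2 + u3 * v3)"

fun zconj :: "'a::comm_ring_1 zorn_matrix \<Rightarrow> 'a zorn_matrix" where
  "zconj (a, (u1, u2, u3), (v1, v2, v3), b) = (b, (- u1, - u2, - u3), (- v1, - v2, - v3), a)"

definition zone :: "'a::comm_ring_1 zorn_matrix" where
  "zone = (1, (0, 0, 0), (0, 0, 0), 1)"

definition zcarrier :: "'a set \<Rightarrow> 'a zorn_matrix set" where
  "zcarrier S = S \<times> (S \<times> S \<times> S) \<times> (S \<times> S \<times> S) \<times> S"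

lemma zorn_matrix_cases:
  obtains xa xu1 xu2 xu3 xv1 xv2 xv3 xb where "x = (xa, (xu1, xu2, xu3), (xv1, xv2, xv3), xb)"
  by (metis surj_pair)

lemma zmul_zone [simp]: "zmul zone x = x" "zmul x zone = x"
  by (cases x rule: zorn_matrix_cases; simp add: zone_def)+

lemma zconj_zone [simp]: "zconj zone = zone"
  by (simp add: zone_def)

lemma zconj_zconj [simp]: "zconj (zconj x) = x"
  by (cases x rule: zorn_matrix_cases) simp

lemma znorm_zone [simp]: "znorm zone = 1"
  by (simp add: zone_def)

lemma znorm_zconj [simp]: "znorm (zconj x) = znorm x"
  by (cases x rule: zorn_matrix_cases) (simp add: algebra_simps)

lemma zconj_zadd: "zconj (zadd x y) = zadd (zconj x) (zconj y)"
  by (cases x rule: zorn_matrix_cases; cases y rule: zorn_matrix_cases) simp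

lemma zconj_zscale: "zconj (zscale r x) = zscale r (zconj x)"
  by (cases x rule: zorn_matrix_cases) simp

lemma zconj_zmul: "zconj (zmul x y) = zmul (zconj y) (zconj x)"
  by (cases x rule: zorn_matrix_cases; cases y rule: zorn_matrix_cases) (simp add: algebra_simps)

lemma znorm_zmul: "znorm (zmul x y) = znorm x * znorm y"
  by (cases x rule: zorn_matrix_cases; cases y rule: zorn_matrix_cases) (simp add: algebra_simps)

text \<open>
  Over a field, the maps \<open>\<theta>\<close> form, up to similarity factors, the spin group of the 7-dimensional trace zero
  part, acting through the spin representation, and \<open>\<tau>\<close> is the associated rotation. The
  norm is preserved by \<open>\<tau>\<close> but may be rescaled by \<open>\<theta>\<close>.\<close>

definition spin7_pair :: "'a::comm_ring_1 set \<Rightarrow> ('a zorn_matrix \<Rightarrow> 'a zorn_matrix) \<Rightarrow>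
    ('a zorn_matrix \<Rightarrow> 'a zorn_matrix) \<Rightarrow> bool" where
  "spin7_pair S \<theta> \<tau> \<longleftrightarrow> bij_betw \<theta> (zcarrier S) (zcarrier S) \<and> \<tau> \<in> zcarrier S \<rightarrow> zcarrier S \<and>
    (\<forall>x y. \<theta> (zadd x y) = zadd (\<theta> x) (\<theta> y)) \<and> (\<forall>r x. \<theta> (zscale r x) = zscale r (\<theta> x)) \<and>
    (\<forall>x y. \<theta> (zmul x y) = zmul (\<tau> x) (\<theta> y)) \<and> \<tau> zone = zone \<and> (\<forall>x. znorm (\<tau> x) = znorm x)"

lemma spin7_pair_comp:
  assumes "spin7_pair S \<theta> \<tau>" "spin7_pair S \<theta>' \<tau>'"
  shows "spin7_pair S (\<theta>' \<circ> \<theta>) (\<tau>' \<circ> \<tau>)"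
proof -
  have "bij_betw (\<theta>' \<circ> \<theta>) (zcarrier S) (zcarrier S)"
    using assms by (intro bij_betw_trans[of _ _ "zcarrier S"]) (simp_all add: spin7_pair_def)
  then show ?thesis using assms by (simp add: spin7_pair_def Pi_iff)
qed

text \<open>
  The maps that also preserve the norm under \<open>\<theta>\<close>, so that an element of invertible norm stays one.\<close>

definition spin7_carries :: "'a::comm_ring_1 set \<Rightarrow> 'a zorn_matrix \<Rightarrow> 'a zorn_matrix \<Rightarrow> bool" where
  "spin7_carries S x y \<longleftrightarrow>
    (\<exists>\<theta> \<tau>. spin7_pair S \<theta> \<tau> \<and> (\<forall>z. znorm (\<theta> z) = znorm z) \<and> \<theta> x = y)"

lemma spin7_carries_refl: "spin7_carries S x x"
  unfolding spin7_carries_def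
  by (rule exI[of _ id], rule exI[of _ id]) (simp add: spin7_pair_def)

lemma spin7_carries_trans [trans]:
  assumes "spin7_carries S x y" "spin7_carries S y z"
  shows "spin7_carries S x z"
proof -
  obtain \<theta> \<tau> \<theta>' \<tau>' where *: "spin7_pair S \<theta> \<tau>" "\<forall>z. znorm (\<theta> z) = znorm z" "\<theta> x = y"
    "spin7_pair S \<theta>' \<tau>'" "\<forall>z. znorm (\<theta>' z) = znorm z" "\<theta>' y = z"
    using assms unfolding spin7_carries_def by blast
  show ?thesis
    unfolding spin7_carries_def
    by (rule exI[of _ "\<theta>' \<circ> \<theta>"], rule exI[of _ "\<tau>' \<circ> \<tau>"]) (use * in \<open>simp add: spin7_pair_comp\<close>)
qed

lemma spin7_carries_norm: "spin7_carries S x y \<Longrightarrow> znorm y = znorm x"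
  unfolding spin7_carries_def by blast

lemma spin7_carries_closed:
  "spin7_carries S x y \<Longrightarrow> x \<in> zcarrier S \<Longrightarrow> y \<in> zcarrier S"
  unfolding spin7_carries_def spin7_pair_def by (auto dest: bij_betwE)

text \<open>
  The cyclic permutation is an algebra automorphism; it reduces the \<open>SL\<^sub>2\<close> moves on the pairs
  \<open>(\<alpha>, u\<^sub>i)\<close> to the case \<open>i = 1\<close>.\<close>

fun zcycle :: "'a zorn_matrix \<Rightarrow> 'a zorn_matrix" where
  "zcycle (a, (u1, u2, u3), (v1, v2, v3), b) = (a, (u2, u3, u1), (v2, v3, v1), b)"

lemma spin7_carries_cycle: "spin7_carries S x (zcycle x)"
  unfolding spin7_carries_def
proof (intro exI conjI allI)
  have "zcycle (zcycle (zcycle x)) = x" for x :: "'a zorn_matrix"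
    by (cases x rule: zorn_matrix_cases) simp
  moreover have closed: "zcycle x \<in> zcarrier S" if "x \<in> zcarrier S" for x
    using that by (cases x rule: zorn_matrix_cases) (simp add: zcarrier_def)
  ultimately have "bij_betw zcycle (zcarrier S) (zcarrier S)"
    by (intro bij_betw_byWitness[of _ "\<lambda>x. zcycle (zcycle x)"]) (simp_all add: image_subset_iff)
  moreover have "zcycle (zadd x y) = zadd (zcycle x) (zcycle y)"
    "zcycle (zmul x y) = zmul (zcycle x) (zcycle y)" for x y :: "'a zorn_matrix"
    by (cases x rule: zorn_matrix_cases; cases y rule: zorn_matrix_cases; simp add: algebra_simps)+
  moreover have "zcycle (zscale r x) = zscale r (zcycle x)" for r and x :: "'a zorn_matrix"
    by (cases x rule: zorn_matrix_cases) simp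
  moreover show "znorm (zcycle x) = znorm x" for x :: "'a zorn_matrix"
    by (cases x rule: zorn_matrix_cases) (simp add: algebra_simps)
  ultimately show "spin7_pair S zcycle zcycle"
    using closed by (simp add: spin7_pair_def zone_def)
qed simp

text \<open>
  The coordinates \<open>\<alpha>, u\<^sub>1, v\<^sub>1, \<beta>\<close> form a subalgebra of \<open>2 \<times> 2\<close> matrices, and Zorn's algebra is its
  Cayley-Dickson double. For a matrix \<open>g\<close> of determinant \<open>1\<close>, with columns
  \<open>(p, q)\<close> and \<open>(r, s)\<close>, right multiplication by \<open>g\<close> on this
  subalgebra and the identity on its complement satisfy \<open>\<theta> (x y) = \<tau> x \<cdot> \<theta> y\<close>, where \<open>\<tau>\<close> is the
  identity on the subalgebra and sends \<open>y j\<close> to \<open>(y g) j\<close> on the complement, for \<open>y\<close> in the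
  subalgebra and \<open>j\<close> the doubling element.
  The formula for \<open>\<tau>\<close> (\<open>zrow_op'\<close>) is read off from \<open>\<tau> x = \<theta> x \<cdot> (\<theta> 1)\<^sup>-\<^sup>1\<close>.\<close>

fun zrow_op :: "'a::comm_ring_1 \<Rightarrow> 'a \<Rightarrow> 'a \<Rightarrow> 'a \<Rightarrow> 'a zorn_matrix \<Rightarrow> 'a zorn_matrix" where
  "zrow_op p q r s (a, (u1, u2, u3), (v1, v2, v3), b) =
    (p * a + q * u1, (r * a + s * u1, u2, u3), (p * v1 + q * b, v2, v3), r * v1 + s * b)"

fun zrow_op' :: "'a::comm_ring_1 \<Rightarrow> 'a \<Rightarrow> 'a \<Rightarrow> 'a \<Rightarrow> 'a zorn_matrix \<Rightarrow> 'a zorn_matrix" where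
  "zrow_op' p q r s (a, (u1, u2, u3), (v1, v2, v3), b) =
    (a, (u1, p * u2 + q * v3, p * u3 - q * v2), (v1, s * v2 - r * u3, s * v3 + r * u2), b)"

text \<open>
  The torus element that rescales \<open>\<beta>\<close> and fixes \<open>\<alpha>\<close>. Compatibility with the product forces the weights
  of \<open>\<tau>\<close> on \<open>u\<^sub>1, u\<^sub>2, u\<^sub>3\<close> to have product \<open>d\<^sup>-\<^sup>1\<close>; they are \<open>d\<^sup>-\<^sup>1, 1, 1\<close>.\<close>

fun zdiag :: "'a::comm_ring_1 \<Rightarrow> 'a zorn_matrix \<Rightarrow> 'a zorn_matrix" where
  "zdiag d (a, (u1, u2, u3), (v1, v2, v3), b) = (a, (u1, d * u2, d * u3), (d * v1, v2, v3), d * b)"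

fun zdiag' :: "'a::comm_ring_1 \<Rightarrow> 'a \<Rightarrow> 'a zorn_matrix \<Rightarrow> 'a zorn_matrix" where
  "zdiag' c d (a, (u1, u2, u3), (v1, v2, v3), b) = (a, (c * u1, u2, u3), (d * v1, v2, v3), b)"

text \<open>
  The carrier of \<open>R\<close> is a subring of a type with ring structure, so that identities in Zorn's algebra
  can be checked by computing in the type.\<close>

locale subring_record =
  fixes S :: "'a::comm_ring_1 set" and R :: "'a ring"
  assumes R_eq: "R = \<lparr>carrier = S, monoid.mult = (*), one = 1, zero = 0, add = (+)\<rparr>"
    and cring_R: "cring R"
begin

sublocale cring R by (rule cring_R)

lemma zero_S: "0 \<in> S" and one_S: "1 \<in> S"
  using zero_closed one_closed by (simp_all add: R_eq)

lemma add_S: "x \<in> S \<Longrightarrow> y \<in> S \<Longrightarrow> x + y \<in> S" and mult_S: "x \<in> S \<Longrightarrow> y \<in> S \<Longrightarrow> x * y \<in> S"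
  using a_closed[of x y] m_closed[of x y] by (simp_all add: R_eq)

lemma a_inv_eq: "x \<in> S \<Longrightarrow> \<ominus>\<^bsub>R\<^esub> x = - x"
  using l_neg[of x] by (simp add: R_eq eq_neg_iff_add_eq_0)

lemma uminus_S: "x \<in> S \<Longrightarrow> - x \<in> S"
  using a_inv_closed[of x] by (simp add: a_inv_eq) (simp add: R_eq)

lemma a_minus_eq: "x \<in> S \<Longrightarrow> y \<in> S \<Longrightarrow> x \<ominus>\<^bsub>R\<^esub> y = x - y"
  using a_inv_eq[of y] by (simp add: a_minus_def) (simp add: R_eq)

lemma diff_S: "x \<in> S \<Longrightarrow> y \<in> S \<Longrightarrow> x - y \<in> S"
  using add_S[OF _ uminus_S, of x y] by simp

lemmas closed_S = zero_S one_S add_S mult_S uminus_S diff_S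

lemma zorn_carrier: "carrier (zorn_algebra R) = zcarrier S"
  by (simp add: zorn_algebra_def zcarrier_def R_eq)

lemma zorn_one: "\<one>\<^bsub>zorn_algebra R\<^esub> = zone"
  by (simp add: zorn_algebra_def zone_def R_eq)

lemma zorn_add: "x \<oplus>\<^bsub>zorn_algebra R\<^esub> y = zadd x y"
  by (cases x rule: zorn_matrix_cases; cases y rule: zorn_matrix_cases)
    (simp add: zorn_algebra_def vadd3_def R_eq)

lemma zorn_scale: "r \<odot>\<^bsub>zorn_algebra R\<^esub> x = zscale r x"
  by (cases x rule: zorn_matrix_cases) (simp add: zorn_algebra_def vsmult3_def R_eq)

lemma zorn_mult:
  assumes "x \<in> zcarrier S" "y \<in> zcarrier S"
  shows "x \<otimes>\<^bsub>zorn_algebra R\<^esub> y = zmul x y"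
proof -
  have R: "x \<oplus>\<^bsub>R\<^esub> y = x + y" "x \<otimes>\<^bsub>R\<^esub> y = x * y" for x y by (simp_all add: R_eq)
  show ?thesis
    using assms
    by (cases x rule: zorn_matrix_cases; cases y rule: zorn_matrix_cases)
      (simp add: zorn_algebra_def zorn_mult_def vadd3_def vsub3_def vsmult3_def vcross3_def dot3_def
        zcarrier_def R a_minus_eq closed_S)
qed

lemma zmul_closed: "x \<in> zcarrier S \<Longrightarrow> y \<in> zcarrier S \<Longrightarrow> zmul x y \<in> zcarrier S"
  by (cases x rule: zorn_matrix_cases; cases y rule: zorn_matrix_cases) (simp add: zcarrier_def closed_S)

lemma zconj_closed: "x \<in> zcarrier S \<Longrightarrow> zconj x \<in> zcarrier S"
  by (cases x rule: zorn_matrix_cases) (simp add: zcarrier_def closed_S)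

lemma znorm_closed: "x \<in> zcarrier S \<Longrightarrow> znorm x \<in> S"
  by (cases x rule: zorn_matrix_cases) (simp add: zcarrier_def closed_S)

lemma spin7_carries_row_op:
  assumes "{p, q, r, s} \<subseteq> S" and det: "p * s - q * r = 1"
  shows "spin7_carries S x (zrow_op p q r s x)"
  unfolding spin7_carries_def
proof (intro exI conjI allI)
  have ps: "p * s = 1 + q * r" using det by (simp add: algebra_simps)
  \<comment> \<open>The determinant condition as rewrite rules that eliminate the product of \<open>p\<close> and \<open>s\<close>.\<close>
  have ps': "p * (s * t) = t + q * (r * t)" for t
    using arg_cong[OF ps, of "\<lambda>y. y * t"] by (simp add: algebra_simps)
  have closed: "zrow_op p' q' r' s' x \<in> zcarrier S" "zrow_op' p' q' r' s' x \<in> zcarrier S"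
    if "{p', q', r', s'} \<subseteq> S" "x \<in> zcarrier S" for p' q' r' s' x
    using that by (cases x rule: zorn_matrix_cases; simp add: zcarrier_def closed_S)+
  have "bij_betw (zrow_op p q r s) (zcarrier S) (zcarrier S)"
  proof (rule bij_betw_byWitness[of _ "zrow_op s (- q) (- r) p"])
    show "\<forall>x\<in>zcarrier S. zrow_op s (- q) (- r) p (zrow_op p q r s x) = x"
      "\<forall>x\<in>zcarrier S. zrow_op p q r s (zrow_op s (- q) (- r) p x) = x"
      by (simp_all add: zcarrier_def algebra_simps ps' ps split: prod.splits)
    show "zrow_op p q r s ` zcarrier S \<subseteq> zcarrier S"
      "zrow_op s (- q) (- r) p ` zcarrier S \<subseteq> zcarrier S"
      using closed(1) assms(1) by (simp_all add: image_subset_iff uminus_S)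
  qed
  moreover have "zrow_op' p q r s \<in> zcarrier S \<rightarrow> zcarrier S"
    using closed(2) assms(1) by (simp add: Pi_iff)
  moreover have "zrow_op p q r s (zadd x y) = zadd (zrow_op p q r s x) (zrow_op p q r s y)" for x y
    by (cases x rule: zorn_matrix_cases; cases y rule: zorn_matrix_cases) (simp add: algebra_simps)
  moreover have "zrow_op p q r s (zscale t x) = zscale t (zrow_op p q r s x)" for t x
    by (cases x rule: zorn_matrix_cases) (simp add: algebra_simps)
  moreover have "zrow_op p q r s (zmul x y) = zmul (zrow_op' p q r s x) (zrow_op p q r s y)" for x y
    by (cases x rule: zorn_matrix_cases; cases y rule: zorn_matrix_cases) (simp add: algebra_simps ps ps')
  moreover have "zrow_op' p q r s zone = zone" by (simp add: zone_def)
  moreover have "znorm (zrow_op' p q r s x) = znorm x" for x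
    by (cases x rule: zorn_matrix_cases) (simp add: algebra_simps ps ps')
  ultimately show "spin7_pair S (zrow_op p q r s) (zrow_op' p q r s)"
    by (simp add: spin7_pair_def)
  show "znorm (zrow_op p q r s x) = znorm x" for x
    by (cases x rule: zorn_matrix_cases) (simp add: algebra_simps ps ps')
qed simp

lemma spin7_carries_sl2_step:
  assumes "sl2_step S (a, u1, u2, u3) (a', u1', u2', u3')"
  shows "\<exists>v' b'. spin7_carries S (a, (u1, u2, u3), v, b) (a', (u1', u2', u3'), v', b')"
proof -
  obtain v1 v2 v3 where v: "v = (v1, v2, v3)" by (cases v)
  from assms show ?thesis
  proof cases
    case (sl2_12 p q r s)
    have "spin7_carries S (a, (u1, u2, u3), v, b) (zrow_op p q r s (a, (u1, u2, u3), v, b))"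
      using sl2_12 by (intro spin7_carries_row_op) auto
    then show ?thesis using sl2_12 v by auto
  next
    case (sl2_13 p q r s)
    have "spin7_carries S (a, (u1, u2, u3), v, b) (zcycle (a, (u1, u2, u3), v, b))"
      by (rule spin7_carries_cycle)
    also have "spin7_carries S \<dots> (zrow_op p q r s (zcycle (a, (u1, u2, u3), v, b)))"
      using sl2_13 by (intro spin7_carries_row_op) auto
    also have "spin7_carries S \<dots> (zcycle (zrow_op p q r s (zcycle (a, (u1, u2, u3), v, b))))"
      by (rule spin7_carries_cycle)
    also have "spin7_carries S \<dots> (zcycle (zcycle (zrow_op p q r s (zcycle (a, (u1, u2, u3), v, b)))))"
      by (rule spin7_carries_cycle)
    finally show ?thesis using sl2_13 v by auto
  next
    case (sl2_14 p q r s)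
    have "spin7_carries S (a, (u1, u2, u3), v, b) (zcycle (a, (u1, u2, u3), v, b))"
      by (rule spin7_carries_cycle)
    also have "spin7_carries S \<dots> (zcycle (zcycle (a, (u1, u2, u3), v, b)))"
      by (rule spin7_carries_cycle)
    also have "spin7_carries S \<dots> (zrow_op p q r s (zcycle (zcycle (a, (u1, u2, u3), v, b))))"
      using sl2_14 by (intro spin7_carries_row_op) auto
    also have "spin7_carries S \<dots> (zcycle (zrow_op p q r s (zcycle (zcycle (a, (u1, u2, u3), v, b)))))"
      by (rule spin7_carries_cycle)
    finally show ?thesis using sl2_14 v by auto
  qed
qed

lemma spin7_carries_sl2_equiv:
  assumes "sl2_equiv S x y"
  shows "\<exists>v' b'. spin7_carries S (fst x, snd x, v, b) (fst y, snd y, v', b')"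
  using assms
proof (induction rule: rtranclp_induct)
  case base
  show ?case using spin7_carries_refl by blast
next
  case (step y z)
  then obtain v' b' where "spin7_carries S (fst x, snd x, v, b) (fst y, snd y, v', b')" by blast
  also obtain v'' b'' where "spin7_carries S (fst y, snd y, v', b') (fst z, snd z, v'', b'')"
    using step(2) spin7_carries_sl2_step[of "fst y" "fst (snd y)" "fst (snd (snd y))" "snd (snd (snd y))"
      "fst z" "fst (snd z)" "fst (snd (snd z))" "snd (snd (snd z))" v' b'] by auto
  finally show ?case by blast
qed

text \<open>
  With \<open>g\<close> lower unitriangular, the row \<open>(1, 0)\<close> of the matrix with rows \<open>(1, 0)\<close> and \<open>(v\<^sub>1, b)\<close>
  is fixed and \<open>v\<^sub>1\<close> changes by a multiple of the unit \<open>b\<close>.\<close>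

lemma spin7_carries_clear_lower:
  assumes v: "{v1, v2, v3, b, b'} \<subseteq> S" and b: "b * b' = 1"
  shows "spin7_carries S (1, (0, 0, 0), (v1, v2, v3), b) (1, (0, 0, 0), (0, 0, 0), b)"
proof -
  have clear: "spin7_carries S (1, (0, 0, 0), (w1, w2, w3), b) (1, (0, 0, 0), (0, w2, w3), b)"
    if "w1 \<in> S" for w1 w2 w3
  proof -
    have "zrow_op 1 (- (b' * w1)) 0 1 (1, (0, 0, 0), (w1, w2, w3), b) = (1, (0, 0, 0), (0, w2, w3), b)"
      using b by (simp add: ac_simps) (simp add: mult.assoc[symmetric])
    moreover have "spin7_carries S (1, (0, 0, 0), (w1, w2, w3), b)
        (zrow_op 1 (- (b' * w1)) 0 1 (1, (0, 0, 0), (w1, w2, w3), b))"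
      using v that by (intro spin7_carries_row_op) (auto simp: closed_S)
    ultimately show ?thesis by simp
  qed
  have cycle: "spin7_carries S (1, (0, 0, 0), (w1, w2, w3), b) (1, (0, 0, 0), (w2, w3, w1), b)"
    for w1 w2 w3
    using spin7_carries_cycle[of S "(1, (0, 0, 0), (w1, w2, w3), b)"] by simp
  have "spin7_carries S (1, (0, 0, 0), (v1, v2, v3), b) (1, (0, 0, 0), (0, v2, v3), b)"
    using v by (intro clear) auto
  also note cycle
  also have "spin7_carries S (1, (0, 0, 0), (v2, v3, 0), b) (1, (0, 0, 0), (0, v3, 0), b)"
    using v by (intro clear) auto
  also note cycle
  also have "spin7_carries S (1, (0, 0, 0), (v3, 0, 0), b) (1, (0, 0, 0), (0, 0, 0), b)"
    using v by (intro clear) auto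
  finally show ?thesis .
qed

lemma spin7_pair_diagonal:
  assumes c: "c \<in> S" "d \<in> S" "c * d = 1"
  shows "spin7_pair S (zdiag d) (zdiag' c d)"
proof -
  have cd: "c * (d * t) = t" "d * (c * t) = t" for t
    using c(3) by (simp_all add: mult.assoc[symmetric] mult.commute[of d c])
  have closed: "zdiag e x \<in> zcarrier S" "zdiag' c d x \<in> zcarrier S"
    if "x \<in> zcarrier S" "e \<in> S" for e x
    using that c by (cases x rule: zorn_matrix_cases; simp add: zcarrier_def closed_S)+
  have "zdiag c (zdiag d x) = x \<and> zdiag d (zdiag c x) = x" for x
    by (cases x rule: zorn_matrix_cases) (simp add: cd)
  then have "bij_betw (zdiag d) (zcarrier S) (zcarrier S)"
    by (intro bij_betw_byWitness[of _ "zdiag c"]) (simp_all add: image_subset_iff closed c)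
  moreover have "zdiag d (zadd x y) = zadd (zdiag d x) (zdiag d y)" for x y
    by (cases x rule: zorn_matrix_cases; cases y rule: zorn_matrix_cases)
      (simp add: algebra_simps)
  moreover have "zdiag d (zmul x y) = zmul (zdiag' c d x) (zdiag d y)" for x y
    by (cases x rule: zorn_matrix_cases; cases y rule: zorn_matrix_cases)
      (simp add: algebra_simps c(3) cd)
  moreover have "zdiag d (zscale r x) = zscale r (zdiag d x)" for r x
    by (cases x rule: zorn_matrix_cases) (simp add: ac_simps)
  moreover have "znorm (zdiag' c d x) = znorm x" for x
    by (cases x rule: zorn_matrix_cases) (simp add: ac_simps c(3) cd)
  ultimately show ?thesis using closed c by (simp add: spin7_pair_def zone_def Pi_iff)
qed

text \<open>
  After the row \<open>(\<alpha>, u)\<close> has become \<open>(1, 0)\<close>, the norm is the last entry, which is thus a unit.\<close>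

lemma spin7_pair_to_one:
  assumes x: "x \<in> zcarrier S" and unit: "c \<in> S" "znorm x * c = 1"
    and row: "sl2_equiv S (fst x, fst (snd x)) (1, 0, 0, 0)"
  obtains \<theta> \<tau> where "spin7_pair S \<theta> \<tau>" "\<theta> x = zone"
proof -
  obtain v b where v: "spin7_carries S x (1, (0, 0, 0), v, b)"
    using spin7_carries_sl2_equiv[OF row, of "fst (snd (snd x))" "snd (snd (snd x))"] by auto
  obtain v1 v2 v3 where v_eq: "v = (v1, v2, v3)" by (cases v)
  have "(1, (0, 0, 0), v, b) \<in> zcarrier S" using spin7_carries_closed[OF v x] .
  then have mem: "{v1, v2, v3, b, c} \<subseteq> S" using unit by (auto simp: zcarrier_def v_eq)
  have bc: "b * c = 1" using spin7_carries_norm[OF v] unit(2) by (simp add: v_eq)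
  have "spin7_carries S x (1, (0, 0, 0), (0, 0, 0), b)"
    using v spin7_carries_clear_lower[OF mem bc] spin7_carries_trans unfolding v_eq by blast
  then obtain \<theta> \<tau> where 1: "spin7_pair S \<theta> \<tau>" "\<theta> x = (1, (0, 0, 0), (0, 0, 0), b)"
    unfolding spin7_carries_def by blast
  have 2: "spin7_pair S (zdiag c) (zdiag' b c)" using spin7_pair_diagonal[of b c] mem bc by simp
  show thesis
    by (rule that[OF spin7_pair_comp[OF 1(1) 2(1)]]) (use 1(2) bc in \<open>simp add: zone_def mult.commute\<close>)
qed

text \<open>
  The reduction explained at the beginning: \<open>\<theta>\<close> and \<open>\<tau>\<close> are conjugates of a pair that moves the
  conjugate of \<open>p\<close> to \<open>1\<close>, and the second pair then moves \<open>\<tau> q\<close> to \<open>1\<close> while fixing \<open>1 = \<theta> p\<close>.\<close>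

theorem isotope_split:
  fixes A :: "('a, 'b) module"
  assumes rows: "\<And>a u1 u2 u3 p q1 q2 q3. {a, u1, u2, u3, p, q1, q2, q3} \<subseteq> S \<Longrightarrow>
      p * a + q1 * u1 + q2 * u2 + q3 * u3 = 1 \<Longrightarrow> sl2_equiv S (a, u1, u2, u3) (1, 0, 0, 0)"
    and iso: "isotope_of R A (zorn_algebra R)"
  shows "split_octonion R A"
proof -
  have to_one: "\<exists>\<theta> \<tau>. spin7_pair S \<theta> \<tau> \<and> \<theta> x = zone"
    if x: "x \<in> zcarrier S" and unit: "c \<in> S" "znorm x * c = 1" for x c
  proof -
    obtain a u1 u2 u3 v1 v2 v3 b where x_eq: "x = (a, (u1, u2, u3), (v1, v2, v3), b)"
      by (rule zorn_matrix_cases)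
    have "(b * c) * a + (- v1 * c) * u1 + (- v2 * c) * u2 + (- v3 * c) * u3 = znorm x * c"
      by (simp add: x_eq algebra_simps)
    then have "sl2_equiv S (a, u1, u2, u3) (1, 0, 0, 0)"
      using x unit by (intro rows[of _ _ _ _ "b * c" "- v1 * c" "- v2 * c" "- v3 * c"])
        (auto simp: x_eq zcarrier_def closed_S)
    then have "sl2_equiv S (fst x, fst (snd x)) (1, 0, 0, 0)" by (simp add: x_eq)
    then show ?thesis using spin7_pair_to_one[OF x unit] by blast
  qed
  let ?C = "zorn_algebra R"
  have A: "unital_algebra R A" using iso by (simp add: isotope_of_def)
  interpret A: unital_algebra R A by (rule A)
  obtain a b f where a: "alg_invertible ?C a" and b: "alg_invertible ?C b"
    and f: "f \<in> alg_iso R A (isotope_alg ?C a b)"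
    using iso by (auto simp: isotope_of_def alg_isomorphic_def)
  have ab: "a \<in> zcarrier S" "b \<in> zcarrier S" using a b by (simp_all add: alg_invertible_def zorn_carrier)
  have bij: "bij_betw f (carrier A) (zcarrier S)"
    using f by (simp add: alg_iso_def isotope_alg_def zorn_carrier)
  then have f_in: "f x \<in> zcarrier S" if "x \<in> carrier A" for x
    using that by (auto dest: bij_betwE)
  have f_add: "f (x \<oplus>\<^bsub>A\<^esub> y) = zadd (f x) (f y)" if "x \<in> carrier A" "y \<in> carrier A" for x y
    using f that by (simp add: alg_iso_def isotope_alg_def zorn_add)
  have f_scale: "f (r \<odot>\<^bsub>A\<^esub> x) = zscale r (f x)" if "r \<in> carrier R" "x \<in> carrier A" for r x
    using f that by (simp add: alg_iso_def isotope_alg_def zorn_scale)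
  define G where "G x = zmul (f x) a" for x
  define H where "H x = zmul b (f x)" for x
  have GH: "G x \<in> zcarrier S" "H x \<in> zcarrier S" if "x \<in> carrier A" for x
    using that ab f_in by (simp_all add: G_def H_def zmul_closed)
  have f_mult: "f (x \<otimes>\<^bsub>A\<^esub> y) = zmul (G x) (H y)" if "x \<in> carrier A" "y \<in> carrier A" for x y
    using f that ab f_in
    by (simp add: alg_iso_def isotope_alg_def G_def H_def zorn_mult zmul_closed)
  define p where "p = G \<one>\<^bsub>A\<^esub>"
  define q where "q = H \<one>\<^bsub>A\<^esub>"
  have pq: "p \<in> zcarrier S" "q \<in> zcarrier S" using GH A.unit_closed by (simp_all add: p_def q_def)
  have "zone \<in> zcarrier S" using zorn_unital_algebra[OF cring_R]
    by (metis unital_algebra.unit_closed zorn_carrier zorn_one)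
  then obtain z where z: "z \<in> carrier A" "f z = zone"
    using bij by (metis bij_betw_imp_surj_on imageE)
  \<comment> \<open>The norms of \<open>p\<close> and \<open>q\<close> are units since \<open>p\<close> and \<open>q\<close> are one-sided inverses of \<open>b\<close> and \<open>a\<close>: evaluate the product formula at the preimage \<open>z\<close> of \<open>1\<close>.\<close>
  have "zmul p b = zone"
    using f_mult[OF A.unit_closed z(1)] z A.unit_left by (simp add: p_def H_def)
  then have p_unit: "znorm p * znorm b = 1" by (metis znorm_zmul znorm_zone)
  have "zmul a q = zone"
    using f_mult[OF z(1) A.unit_closed] z A.unit_right by (simp add: q_def G_def)
  then have q_unit: "znorm q * znorm a = 1" by (metis znorm_zmul znorm_zone mult.commute)
  obtain \<theta>1 \<tau>1 where s1: "spin7_pair S \<theta>1 \<tau>1" "\<theta>1 (zconj p) = zone"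
    using to_one[of "zconj p" "znorm b"] pq ab p_unit by (auto simp: zconj_closed znorm_closed)
  define \<theta> where "\<theta> = zconj \<circ> \<theta>1 \<circ> zconj"
  define \<tau> where "\<tau> = zconj \<circ> \<tau>1 \<circ> zconj"
  have conj_bij: "bij_betw zconj (zcarrier S) (zcarrier S)"
    by (rule bij_betw_byWitness[of _ zconj]) (simp_all add: zconj_closed image_subset_iff)
  have \<theta>_bij: "bij_betw \<theta> (zcarrier S) (zcarrier S)"
    unfolding \<theta>_def using s1(1) conj_bij by (auto simp: spin7_pair_def intro!: bij_betw_trans)
  have \<theta>_mult: "\<theta> (zmul x y) = zmul (\<theta> x) (\<tau> y)" for x y
    using s1(1) by (simp add: \<theta>_def \<tau>_def spin7_pair_def zconj_zmul)
  have \<theta>_p: "\<theta> p = zone" using s1(2) by (simp add: \<theta>_def)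
  have \<tau>_in: "\<tau> x \<in> zcarrier S" if "x \<in> zcarrier S" for x
    using s1(1) that by (auto simp: \<tau>_def spin7_pair_def zconj_closed Pi_iff)
  have "znorm (\<tau> q) = znorm q" using s1(1) by (simp add: \<tau>_def spin7_pair_def)
  then obtain \<theta>2 \<tau>2 where s2: "spin7_pair S \<theta>2 \<tau>2" "\<theta>2 (\<tau> q) = zone"
    using to_one[of "\<tau> q" "znorm a"] pq ab q_unit \<tau>_in by (auto simp: znorm_closed)
  define \<Psi> where "\<Psi> = \<theta>2 \<circ> \<theta> \<circ> f"
  have \<Psi>_GH: "\<Psi> (x \<otimes>\<^bsub>A\<^esub> y) = zmul (\<tau>2 (\<theta> (G x))) (\<theta>2 (\<tau> (H y)))"
    if "x \<in> carrier A" "y \<in> carrier A" for x y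
    using s2(1) by (simp add: \<Psi>_def f_mult[OF that] \<theta>_mult spin7_pair_def)
  have \<Psi>_H: "\<Psi> x = \<theta>2 (\<tau> (H x))" if "x \<in> carrier A" for x
    using \<Psi>_GH[OF A.unit_closed that] A.unit_left[OF that] s2(1)
    by (simp add: p_def[symmetric] \<theta>_p spin7_pair_def)
  have \<Psi>_G: "\<Psi> x = \<tau>2 (\<theta> (G x))" if "x \<in> carrier A" for x
    using \<Psi>_GH[OF that A.unit_closed] A.unit_right[OF that] s2(2)
    by (simp add: q_def[symmetric])
  have \<Psi>_bij: "bij_betw \<Psi> (carrier A) (zcarrier S)"
    unfolding \<Psi>_def using bij \<theta>_bij s2(1) by (auto simp: spin7_pair_def intro!: bij_betw_trans)
  then have \<Psi>_in: "\<Psi> x \<in> zcarrier S" if "x \<in> carrier A" for x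
    using that by (auto dest: bij_betwE)
  have "\<Psi> \<in> alg_iso R A ?C"
    unfolding alg_iso_def
  proof (intro CollectI conjI ballI)
    show "bij_betw \<Psi> (carrier A) (carrier ?C)" using \<Psi>_bij by (simp add: zorn_carrier)
    show "\<Psi> (x \<oplus>\<^bsub>A\<^esub> y) = \<Psi> x \<oplus>\<^bsub>?C\<^esub> \<Psi> y" if "x \<in> carrier A" "y \<in> carrier A" for x y
      using s1(1) s2(1) by (simp add: \<Psi>_def \<theta>_def f_add[OF that] spin7_pair_def zconj_zadd zorn_add)
    show "\<Psi> (r \<odot>\<^bsub>A\<^esub> x) = r \<odot>\<^bsub>?C\<^esub> \<Psi> x" if "r \<in> carrier R" "x \<in> carrier A" for r x
      using s1(1) s2(1) by (simp add: \<Psi>_def \<theta>_def f_scale[OF that] spin7_pair_def zconj_zscale zorn_scale)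
    show "\<Psi> (x \<otimes>\<^bsub>A\<^esub> y) = \<Psi> x \<otimes>\<^bsub>?C\<^esub> \<Psi> y" if "x \<in> carrier A" "y \<in> carrier A" for x y
      using \<Psi>_GH[OF that] \<Psi>_G[OF that(1)] \<Psi>_H[OF that(2)] zorn_mult[OF \<Psi>_in[OF that(1)] \<Psi>_in[OF that(2)]]
      by simp
    show "\<Psi> \<one>\<^bsub>A\<^esub> = \<one>\<^bsub>?C\<^esub>"
      using \<Psi>_H[OF A.unit_closed] s2(2) by (simp add: q_def[symmetric] zorn_one)
  qed
  then show ?thesis using A by (auto simp: split_octonion_def alg_isomorphic_def)
qed

end

section \<open>Homomorphisms from monoid algebras\<close>

abbreviation keys where "keys \<equiv> Poly_Mapping.keys"
abbreviation lookup where "lookup \<equiv> Poly_Mapping.lookup"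
abbreviation single where "single \<equiv> Poly_Mapping.single"

lemma sum_single_lookup: "(\<Sum>e\<in>keys p. single e (lookup p e)) = p"
  by (rule poly_mapping_eqI) (auto simp: lookup_sum lookup_single when_def in_keys_iff sum.delta')

definition ring_map :: "('a::comm_ring_1 \<Rightarrow> 'b::comm_ring_1) \<Rightarrow> bool" where
  "ring_map f \<longleftrightarrow> f 0 = 0 \<and> f 1 = 1 \<and> (\<forall>x y. f (x + y) = f x + f y) \<and> (\<forall>x y. f (x * y) = f x * f y)"

text \<open>
  The homomorphism from a monoid algebra that is given by \<open>\<kappa>\<close> on coefficients and \<open>\<mu>\<close> on monomials.\<close>

definition monomial_eval :: "('a::comm_ring_1 \<Rightarrow> 'b::comm_ring_1) \<Rightarrow> ('e \<Rightarrow> 'b) \<Rightarrow> ('e \<Rightarrow>\<^sub>0 'a) \<Rightarrow> 'b" where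
  "monomial_eval \<kappa> \<mu> p = (\<Sum>e\<in>keys p. \<kappa> (lookup p e) * \<mu> e)"

lemma monomial_eval_add:
  "ring_map \<kappa> \<Longrightarrow> monomial_eval \<kappa> \<mu> (p + q) = monomial_eval \<kappa> \<mu> p + monomial_eval \<kappa> \<mu> q"
  unfolding monomial_eval_def
  by (rule Poly_Mapping.setsum_keys_plus_distrib) (simp_all add: ring_map_def distrib_right)

lemma monomial_eval_0 [simp]: "monomial_eval \<kappa> \<mu> 0 = 0"
  by (simp add: monomial_eval_def)

lemma monomial_eval_single: "ring_map \<kappa> \<Longrightarrow> monomial_eval \<kappa> \<mu> (single e c) = \<kappa> c * \<mu> e"
  by (simp add: monomial_eval_def ring_map_def)

lemma monomial_eval_sum:
  "ring_map \<kappa> \<Longrightarrow> monomial_eval \<kappa> \<mu> (\<Sum>i\<in>I. f i) = (\<Sum>i\<in>I. monomial_eval \<kappa> \<mu> (f i))"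
  by (induction I rule: infinite_finite_induct) (simp_all add: monomial_eval_add)

text \<open>
  The set \<open>E\<close> of exponents appears because the substitution used later is multiplicative only
  as long as the exponents of polynomial variables are not negative.\<close>

lemma monomial_eval_mult:
  fixes p q :: "'e::comm_monoid_add \<Rightarrow>\<^sub>0 'a::comm_ring_1"
  assumes \<kappa>: "ring_map \<kappa>" and \<mu>: "\<And>e e'. e \<in> E \<Longrightarrow> e' \<in> E \<Longrightarrow> \<mu> (e + e') = \<mu> e * \<mu> e'"
    and pq: "keys p \<subseteq> E" "keys q \<subseteq> E"
  shows "monomial_eval \<kappa> \<mu> (p * q) = monomial_eval \<kappa> \<mu> p * monomial_eval \<kappa> \<mu> q"
proof -
  have "p * q = (\<Sum>e\<in>keys p. \<Sum>e'\<in>keys q. single (e + e') (lookup p e * lookup q e'))"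
    by (subst (1 2) sum_single_lookup[symmetric]) (simp add: sum_product mult_single)
  then have "monomial_eval \<kappa> \<mu> (p * q) =
      (\<Sum>e\<in>keys p. \<Sum>e'\<in>keys q. \<kappa> (lookup p e * lookup q e') * \<mu> (e + e'))"
    by (simp add: monomial_eval_sum[OF \<kappa>] monomial_eval_single[OF \<kappa>])
  also have "\<dots> = (\<Sum>e\<in>keys p. \<Sum>e'\<in>keys q. (\<kappa> (lookup p e) * \<mu> e) * (\<kappa> (lookup q e') * \<mu> e'))"
  proof (intro sum.cong refl)
    fix e e' assume "e \<in> keys p" "e' \<in> keys q"
    then have "\<mu> (e + e') = \<mu> e * \<mu> e'" using pq by (intro \<mu>) auto
    moreover have "\<kappa> (lookup p e * lookup q e') = \<kappa> (lookup p e) * \<kappa> (lookup q e')"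
      using \<kappa> by (simp add: ring_map_def)
    ultimately show "\<kappa> (lookup p e * lookup q e') * \<mu> (e + e') =
        (\<kappa> (lookup p e) * \<mu> e) * (\<kappa> (lookup q e') * \<mu> e')"
      by (simp add: ac_simps)
  qed
  finally show ?thesis by (simp add: monomial_eval_def sum_product)
qed

lemma monomial_eval_one:
  fixes \<mu> :: "'e::comm_monoid_add \<Rightarrow> 'b::comm_ring_1" and \<kappa> :: "'a::comm_ring_1 \<Rightarrow> 'b"
  assumes "ring_map \<kappa>" "\<mu> 0 = 1"
  shows "monomial_eval \<kappa> \<mu> 1 = 1"
  using monomial_eval_single[OF assms(1), of \<mu> 0 1] assms by (simp add: ring_map_def)

lemma ring_map_monomial_eval:
  fixes \<mu> :: "'e::comm_monoid_add \<Rightarrow> 'b::comm_ring_1"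
  assumes "ring_map \<kappa>" "\<mu> 0 = 1" "\<And>e e'. \<mu> (e + e') = \<mu> e * \<mu> e'"
  shows "ring_map (monomial_eval \<kappa> \<mu>)"
  using assms monomial_eval_mult[of \<kappa> UNIV \<mu>]
  by (simp add: ring_map_def[of "monomial_eval \<kappa> \<mu>"] monomial_eval_one monomial_eval_add)

lemma ring_map_id: "ring_map id"
  by (simp add: ring_map_def)

lemma ring_map_single: "ring_map (single (0 :: 'e::comm_monoid_add))"
  by (simp add: ring_map_def single_add mult_single)

lemma ring_map_comp: "ring_map f \<Longrightarrow> ring_map g \<Longrightarrow> ring_map (g \<circ> f)"
  by (simp add: ring_map_def)

section \<open>Laurent polynomials in one variable\<close>

definition laurent_of_poly :: "'a::comm_ring_1 poly \<Rightarrow> (int \<Rightarrow>\<^sub>0 'a)" where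
  "laurent_of_poly p = (\<Sum>i\<le>degree p. single (int i) (coeff p i))"

lemma laurent_of_poly_upto:
  "degree p \<le> n \<Longrightarrow> laurent_of_poly p = (\<Sum>i\<le>n. single (int i) (coeff p i))"
  unfolding laurent_of_poly_def by (rule sum.mono_neutral_left) (auto simp: coeff_eq_0)

lemma lookup_laurent_of_poly: "lookup (laurent_of_poly p) (int i) = coeff p i"
  by (auto simp: laurent_of_poly_def lookup_sum lookup_single when_def sum.delta coeff_eq_0)

lemma laurent_of_poly_monom: "laurent_of_poly (monom c i) = single (int i) c"
  by (subst laurent_of_poly_upto[of _ i])
    (simp_all add: degree_monom_le sum.delta if_distrib cong: if_cong)

lemma laurent_of_poly_inject: "laurent_of_poly p = laurent_of_poly q \<Longrightarrow> p = q"
  by (metis lookup_laurent_of_poly poly_eqI)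

lemma laurent_of_poly_0 [simp]: "laurent_of_poly 0 = 0"
  by (simp add: laurent_of_poly_def)

lemma laurent_of_poly_pCons:
  "laurent_of_poly (pCons a p) = single 0 a + single 1 1 * laurent_of_poly p"
proof -
  have "laurent_of_poly (pCons a p) = (\<Sum>i\<le>Suc (degree p). single (int i) (coeff (pCons a p) i))"
    by (rule laurent_of_poly_upto) (rule degree_pCons_le)
  also have "\<dots> = single 0 a + (\<Sum>i\<le>degree p. single (1 + int i) (coeff p i))"
    by (subst sum.atMost_Suc_shift) simp
  also have "(\<Sum>i\<le>degree p. single (1 + int i) (coeff p i)) = single 1 1 * laurent_of_poly p"
    by (simp add: laurent_of_poly_def sum_distrib_left mult_single)
  finally show ?thesis .
qed

lemma laurent_of_poly_1 [simp]: "laurent_of_poly 1 = 1"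
  by (simp add: one_pCons laurent_of_poly_pCons)

lemma laurent_of_poly_add: "laurent_of_poly (p + q) = laurent_of_poly p + laurent_of_poly q"
  by (induction p q rule: poly_induct2) (simp_all add: laurent_of_poly_pCons single_add algebra_simps)

lemma laurent_of_poly_uminus: "laurent_of_poly (- p) = - laurent_of_poly p"
  by (simp add: laurent_of_poly_def single_uminus sum_negf)

lemma laurent_of_poly_diff: "laurent_of_poly (p - q) = laurent_of_poly p - laurent_of_poly q"
  using laurent_of_poly_add[of p "- q"] by (simp add: laurent_of_poly_uminus)

lemma laurent_of_poly_smult: "laurent_of_poly (smult c p) = single 0 c * laurent_of_poly p"
  by (induction p) (simp_all add: laurent_of_poly_pCons mult_single algebra_simps)

lemma laurent_of_poly_mult: "laurent_of_poly (p * q) = laurent_of_poly p * laurent_of_poly q"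
  by (induction p)
    (simp_all add: laurent_of_poly_pCons laurent_of_poly_add laurent_of_poly_smult algebra_simps)

definition laurent_at_one :: "(int \<Rightarrow>\<^sub>0 'a::comm_ring_1) \<Rightarrow> 'a" where
  "laurent_at_one = monomial_eval id (\<lambda>_. 1)"

lemma ring_map_laurent_at_one: "ring_map laurent_at_one"
  unfolding laurent_at_one_def by (rule ring_map_monomial_eval) (simp_all add: ring_map_id)

lemma laurent_at_one_single [simp]: "laurent_at_one (single k c) = c"
  by (simp add: laurent_at_one_def monomial_eval_single ring_map_id)

lemma laurent_at_one_hom:
  "laurent_at_one 0 = 0" "laurent_at_one 1 = 1"
  "laurent_at_one (x + y) = laurent_at_one x + laurent_at_one y"
  "laurent_at_one (x * y) = laurent_at_one x * laurent_at_one y"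
  using ring_map_laurent_at_one unfolding ring_map_def by blast+

lemma laurent_at_one_poly: "laurent_at_one (laurent_of_poly p) = poly p 1"
  by (induction p) (simp_all add: laurent_of_poly_pCons laurent_at_one_hom)

lemma laurent_cases:
  obtains m p where "single (int m) 1 * l = laurent_of_poly p"
proof -
  have "\<exists>m p. single (int m) 1 * (\<Sum>i\<in>I. single i (lookup l i)) = laurent_of_poly p"
    if "finite I" for I
    using that
  proof induction
    case empty
    show ?case by (intro exI[of _ 0]) simp
  next
    case (insert j I)
    then obtain m p where mp: "single (int m) 1 * (\<Sum>i\<in>I. single i (lookup l i)) = laurent_of_poly p"
      by blast
    let ?r = "nat \<bar>j\<bar>"
    have "single (int (m + ?r)) 1 * (\<Sum>i\<in>insert j I. single i (lookup l i)) =
        single (int m + int ?r + j) (lookup l j) +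
        single (int ?r) 1 * (single (int m) 1 * (\<Sum>i\<in>I. single i (lookup l i)))"
      using insert by (simp add: distrib_left mult_single mult.assoc[symmetric] add.commute)
    also have "int m + int ?r + j = int (m + nat (j + \<bar>j\<bar>))" by simp
    also have "single (int (m + nat (j + \<bar>j\<bar>))) (lookup l j) +
          single (int ?r) 1 * (single (int m) 1 * (\<Sum>i\<in>I. single i (lookup l i))) =
        laurent_of_poly (monom (lookup l j) (m + nat (j + \<bar>j\<bar>)) + monom 1 ?r * p)"
      unfolding mp by (simp add: laurent_of_poly_monom laurent_of_poly_add laurent_of_poly_mult)
    finally show ?case by blast
  qed
  from this[of "keys l"] that show thesis by (auto simp: sum_single_lookup)
qed

text \<open>
  With \<open>P = P(0) + x P'\<close>, the inverse of \<open>x\<close> is congruent to \<open>- P(0)\<^sup>-\<^sup>1 P'\<close> modulo \<open>P\<close>, hence to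
  a polynomial.\<close>

lemma laurent_reduce:
  fixes P :: "'a::comm_ring_1 poly"
  assumes unit: "coeff P 0 * c = 1"
  obtains p y where "l = laurent_of_poly p + y * laurent_of_poly P"
proof -
  let ?P = "laurent_of_poly P"
  obtain P' where P': "P = pCons (coeff P 0) P'"
    by (metis coeff_pCons_0 pCons_cases)
  define w where "w = - smult c P'"
  have "single (- 1) c * ?P = single (- 1) c * (single 0 (coeff P 0) + single 1 1 * laurent_of_poly P')"
    by (subst P') (simp only: laurent_of_poly_pCons)
  also have "\<dots> = single (- 1) 1 + single 0 c * laurent_of_poly P'"
    using unit by (simp add: distrib_left mult_single mult.assoc[symmetric] mult.commute[of c])
  finally have X': "single (- 1) 1 = laurent_of_poly w + single (- 1) c * ?P"
    by (simp add: w_def laurent_of_poly_uminus laurent_of_poly_smult algebra_simps)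
  define Q where "Q l \<longleftrightarrow> (\<exists>p y. l = laurent_of_poly p + y * ?P)" for l
  have add: "Q (a + b)" if ab: "Q a" "Q b" for a b
  proof -
    obtain p y q z where "a = laurent_of_poly p + y * ?P" "b = laurent_of_poly q + z * ?P"
      using ab by (auto simp: Q_def)
    then have "a + b = laurent_of_poly (p + q) + (y + z) * ?P"
      by (simp add: laurent_of_poly_add algebra_simps)
    then show ?thesis unfolding Q_def by blast
  qed
  have mult: "Q (a * b)" if ab: "Q a" "Q b" for a b
  proof -
    obtain p y q z where *: "a = laurent_of_poly p + y * ?P" "b = laurent_of_poly q + z * ?P"
      using ab by (auto simp: Q_def)
    have "a * b = laurent_of_poly (p * q) + (laurent_of_poly p * z + y * laurent_of_poly q + y * z * ?P) * ?P"
      unfolding * laurent_of_poly_mult by (simp add: algebra_simps)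
    then show ?thesis unfolding Q_def by blast
  qed
  have poly: "Q (laurent_of_poly p)" for p
    unfolding Q_def by (intro exI[of _ p] exI[of _ 0]) simp
  have inv: "Q (single (- 1) 1)" using X' unfolding Q_def by blast
  have inv_pow: "Q (single (- int m) 1)" for m
  proof (induction m)
    case 0
    show ?case using poly[of 1] by simp
  next
    case (Suc m)
    have "single (- int (Suc m)) 1 = single (- 1) 1 * (single (- int m) (1::'a))"
      by (simp add: mult_single)
    then show ?case using mult[OF inv Suc] by simp
  qed
  obtain m p where "single (int m) 1 * l = laurent_of_poly p" by (rule laurent_cases)
  then have "single (- int m) 1 * laurent_of_poly p = single (- int m) 1 * (single (int m) 1 * l)" by simp
  also have "\<dots> = l" by (simp add: mult.assoc[symmetric] mult_single)
  finally have "l = single (- int m) 1 * laurent_of_poly p" by simp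
  then have "Q l" using mult[OF inv_pow poly] by simp
  then show thesis using that unfolding Q_def by blast
qed

text \<open>
  A Laurent multiple of \<open>P\<close> becomes a polynomial multiple after multiplication by a power of \<open>x\<close>,
  which can be cancelled as \<open>x\<close> and \<open>P\<close> generate the unit ideal.\<close>

lemma laurent_dvd_poly:
  fixes P :: "'a::comm_ring_1 poly"
  assumes unit: "coeff P 0 * c = 1" and eq: "laurent_of_poly z = y * laurent_of_poly P"
  shows "P dvd z"
proof -
  obtain P' where P': "P = pCons (coeff P 0) P'"
    by (metis coeff_pCons_0 pCons_cases)
  define X :: "'a poly" where "X = [:0, 1:]"
  have PX: "P = [:coeff P 0:] + X * P'" by (subst P') (simp add: X_def)
  have "[:c:] * P = [:c * coeff P 0:] + [:c:] * (X * P')"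
    by (subst PX) (simp add: distrib_left mult.assoc)
  then have one: "[:c:] * P - X * ([:c:] * P') = 1"
    using unit by (simp add: ac_simps one_pCons)
  obtain m q where "single (int m) 1 * y = laurent_of_poly q" by (rule laurent_cases)
  then have "single (int m) 1 * laurent_of_poly z = laurent_of_poly (q * P)"
    by (simp add: eq laurent_of_poly_mult mult.assoc[symmetric])
  moreover have "single (int m) 1 = laurent_of_poly (X ^ m)"
    by (simp add: X_def monom_altdef flip: laurent_of_poly_monom)
  ultimately have "laurent_of_poly (X ^ m * z) = laurent_of_poly (q * P)"
    by (simp add: laurent_of_poly_mult)
  then have "P dvd X ^ m * z" using laurent_of_poly_inject by (metis dvd_triv_right)
  then show ?thesis
  proof (induction m)
    case (Suc m)
    let ?z = "X ^ m * z"
    have expand: "(a * P - X * (a * Q)) * t = P * (a * t) - a * Q * (X * t)" for a Q t :: "'a poly"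
      by (simp add: algebra_simps)
    have "?z = ([:c:] * P - X * ([:c:] * P')) * ?z" by (simp only: one mult_1)
    also have "\<dots> = P * ([:c:] * ?z) - [:c:] * P' * (X * ?z)"
      by (rule expand)
    also have "P dvd \<dots>"
      using Suc.prems by (intro dvd_diff dvd_triv_left dvd_mult[of P "X * ?z"]) (simp add: mult.assoc)
    finally show ?case by (rule Suc.IH)
  qed simp
qed

text \<open>
  Modulo \<open>P\<close> the other entries are polynomials \<open>g\<^sub>i\<close>, and so are the coefficients \<open>m\<^sub>i\<close> of the
  unimodularity relation; the relation then holds among \<open>P, g\<^sub>2, g\<^sub>3, g\<^sub>4\<close> over the polynomial
  ring. The values at \<open>x = 1\<close> and at \<open>x = 0\<close> are compared by Suslin's theorem.\<close>

theorem laurent_row_sl2_equiv: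
  fixes l1 l2 l3 l4 :: "int \<Rightarrow>\<^sub>0 'a::comm_ring_1"
  assumes um: "m1 * l1 + m2 * l2 + m3 * l3 + m4 * l4 = 1"
    and l1: "l1 = single k 1 * laurent_of_poly P"
    and lead: "lead_coeff P * u' = 1" and const: "coeff P 0 * c = 1"
  shows "sl2_equiv UNIV (laurent_at_one l1, laurent_at_one l2, laurent_at_one l3, laurent_at_one l4) (1, 0, 0, 0)"
proof -
  let ?P = "laurent_of_poly P"
  define u where "u = lead_coeff P"
  have uu: "u * u' = 1" using lead by (simp add: u_def)
  obtain g2 y2 where g2: "l2 = laurent_of_poly g2 + y2 * ?P" by (rule laurent_reduce[OF const])
  obtain g3 y3 where g3: "l3 = laurent_of_poly g3 + y3 * ?P" by (rule laurent_reduce[OF const])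
  obtain g4 y4 where g4: "l4 = laurent_of_poly g4 + y4 * ?P" by (rule laurent_reduce[OF const])
  obtain h2 z2 where h2: "m2 = laurent_of_poly h2 + z2 * ?P" by (rule laurent_reduce[OF const])
  obtain h3 z3 where h3: "m3 = laurent_of_poly h3 + z3 * ?P" by (rule laurent_reduce[OF const])
  obtain h4 z4 where h4: "m4 = laurent_of_poly h4 + z4 * ?P" by (rule laurent_reduce[OF const])
  have expand: "(h + z * p) * (g + y * p) = h * g + (h * y + z * g + z * y * p) * p"
    for h z p g y :: "int \<Rightarrow>\<^sub>0 'a" by (simp add: algebra_simps)
  have "laurent_of_poly (1 - (h2 * g2 + h3 * g3 + h4 * g4)) =
     (m1 * l1 + m2 * l2 + m3 * l3 + m4 * l4)
     - laurent_of_poly h2 * laurent_of_poly g2 - laurent_of_poly h3 * laurent_of_poly g3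
     - laurent_of_poly h4 * laurent_of_poly g4"
    unfolding um by (simp add: laurent_of_poly_diff laurent_of_poly_add laurent_of_poly_mult)
  also have "\<dots> = (m1 * single k 1
      + (laurent_of_poly h2 * y2 + z2 * laurent_of_poly g2 + z2 * y2 * ?P)
      + (laurent_of_poly h3 * y3 + z3 * laurent_of_poly g3 + z3 * y3 * ?P)
      + (laurent_of_poly h4 * y4 + z4 * laurent_of_poly g4 + z4 * y4 * ?P)) * ?P"
    unfolding l1 g2 g3 g4 h2 h3 h4 expand by (simp add: distrib_right mult.assoc)
  finally have "P dvd 1 - (h2 * g2 + h3 * g3 + h4 * g4)" by (rule laurent_dvd_poly[OF const])
  then obtain t where t: "1 - (h2 * g2 + h3 * g3 + h4 * g4) = P * t" by (elim dvdE)
  define P1 where "P1 = smult u' P"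
  have P: "P = smult u P1" using uu by (simp add: P1_def)
  have monic: "lead_coeff P1 = 1"
  proof -
    have "coeff P1 (degree P) = 1" using uu by (simp add: P1_def u_def mult.commute)
    moreover have "degree P1 \<le> degree P" unfolding P1_def by (rule degree_smult_le)
    ultimately have "degree P1 = degree P" by (metis le_antisym le_degree one_neq_zero)
    then show ?thesis using \<open>coeff P1 (degree P) = 1\<close> by simp
  qed
  have um': "smult u t * P1 + smult u' h2 * smult u g2 + h3 * g3 + h4 * g4 = 1"
  proof -
    have "smult u t * P1 + smult u' h2 * smult u g2 + h3 * g3 + h4 * g4 = P * t + (h2 * g2 + h3 * g3 + h4 * g4)"
      using uu by (simp add: P mult.commute)
    then show ?thesis by (simp flip: t)
  qed
  define e where "e = coeff P1 0"
  define e' where "e' = u * c"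
  have ee': "e' * e = 1"
  proof -
    have "e' * e = (u * u') * (coeff P 0 * c)" by (simp add: e_def e'_def P1_def ac_simps)
    then show ?thesis using uu const by simp
  qed
  let ?y = "\<lambda>y. laurent_at_one y" and ?p = "\<lambda>p. poly p (1::'a)"
  have "sl2_equiv UNIV (?y l1, ?y l2, ?y l3, ?y l4) (?p P, ?p g2, ?p g3, ?p g4)"
    using sl2_equiv_add_first[of "?p P" "?y l2" "?y l3" "?y l4" "- ?y y2" "- ?y y3" "- ?y y4"]
    by (simp add: l1 g2 g3 g4 laurent_at_one_hom laurent_at_one_poly)
  also have "sl2_equiv UNIV \<dots> (?p P1, ?p (smult u g2), ?p g3, ?p g4)"
    using sl2_equiv_12[of u' u 0 0 "?p P" "?p g2" "?p g3" "?p g4"] uu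
    by (simp add: P1_def mult.commute)
  also have "sl2_equiv UNIV \<dots> (poly P1 0, poly (smult u g2) 0, poly g3 0, poly g4 0)"
    by (rule sl2_equiv_poly_eval[OF monic um'])
  also have "sl2_equiv UNIV \<dots> (e, 0, 0, 0)"
    using sl2_equiv_add_first[of e "poly (smult u g2) 0" "poly g3 0" "poly g4 0"
        "- poly (smult u g2) 0 * e'" "- poly g3 0 * e'" "- poly g4 0 * e'"] ee'
    by (simp add: e_def poly_0_coeff_0 mult.assoc)
  also have "sl2_equiv UNIV \<dots> (1, 0, 0, 0)"
    using sl2_equiv_12[of e' e 0 0 e 0 0 0] ee' by simp
  finally show ?thesis .
qed

section \<open>Extreme coefficients of Laurent polynomials\<close>

text \<open>
  The sign \<open>\<sigma>\<close> selects the end: for \<open>\<sigma> = 1\<close> the exponents are bounded above by \<open>h\<close>, for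
  \<open>\<sigma> = -1\<close> they are bounded below by \<open>- h\<close>. Both ends are thus treated by one calculation.\<close>

definition below :: "int \<Rightarrow> int \<Rightarrow> (int \<Rightarrow>\<^sub>0 'a::comm_ring_1) \<Rightarrow> bool" where
  "below \<sigma> h l \<longleftrightarrow> (\<forall>i\<in>keys l. \<sigma> * i \<le> h)"

text \<open>
  The coefficient \<open>u\<close> at the end \<open>\<sigma> h\<close> may be \<open>0\<close>, so that the rule for products holds over every
  commutative ring.\<close>

definition has_end :: "int \<Rightarrow> (int \<Rightarrow>\<^sub>0 'a::comm_ring_1) \<Rightarrow> int \<Rightarrow> 'a \<Rightarrow> bool" where
  "has_end \<sigma> l h u \<longleftrightarrow> below \<sigma> (h - 1) (l - single (\<sigma> * h) u)"

lemma sign_mult_cancel: "\<sigma> * (\<sigma> * h) = h" if "\<sigma> * \<sigma> = 1" for \<sigma> h :: int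
  using that by (metis mult.assoc mult_1)

lemma below_mono: "below \<sigma> h l \<Longrightarrow> h \<le> h' \<Longrightarrow> below \<sigma> h' l"
  by (fastforce simp: below_def)

lemma below_add: "below \<sigma> h l \<Longrightarrow> below \<sigma> h l' \<Longrightarrow> below \<sigma> h (l + l')"
  unfolding below_def using Poly_Mapping.keys_add[of l l'] by blast

lemma below_sum: "(\<And>x. x \<in> A \<Longrightarrow> below \<sigma> h (f x)) \<Longrightarrow> below \<sigma> h (\<Sum>x\<in>A. f x)"
  by (induction A rule: infinite_finite_induct) (simp_all add: below_add, simp_all add: below_def)

lemma below_mult:
  assumes "below \<sigma> h l" "below \<sigma> h' l'"
  shows "below \<sigma> (h + h') (l * l')"
  unfolding below_def
proof
  fix k assume "k \<in> keys (l * l')"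
  then obtain i j where "i \<in> keys l" "j \<in> keys l'" "k = i + j"
    using keys_mult[of l l'] by auto
  then show "\<sigma> * k \<le> h + h'" using assms by (auto simp: below_def distrib_left intro!: add_mono)
qed

lemma below_single: "\<sigma> * k \<le> h \<Longrightarrow> below \<sigma> h (single k u)"
  by (simp add: below_def)

lemma has_end_below:
  assumes "\<sigma> * \<sigma> = 1" "has_end \<sigma> l h u" shows "below \<sigma> h l"
proof -
  have "below \<sigma> h (l - single (\<sigma> * h) u)"
    by (rule below_mono[of \<sigma> "h - 1"]) (use assms(2) in \<open>simp_all add: has_end_def\<close>)
  moreover have "below \<sigma> h (single (\<sigma> * h) u)"
    using assms(1) by (intro below_single) (simp add: sign_mult_cancel)
  ultimately have "below \<sigma> h (l - single (\<sigma> * h) u + single (\<sigma> * h) u)" by (rule below_add)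
  then show ?thesis by simp
qed

lemma has_end_lookup:
  assumes "\<sigma> * \<sigma> = 1" "has_end \<sigma> l h u"
  shows "lookup l (\<sigma> * h) = u" "h < \<sigma> * i \<Longrightarrow> lookup l i = 0"
proof -
  have "\<sigma> * h \<notin> keys (l - single (\<sigma> * h) u)"
    using assms by (auto simp: has_end_def below_def sign_mult_cancel)
  then show "lookup l (\<sigma> * h) = u" by (simp add: in_keys_iff lookup_minus)
  show "lookup l i = 0" if "h < \<sigma> * i"
  proof (rule ccontr)
    assume "lookup l i \<noteq> 0"
    then have "i \<in> keys l" by (simp add: in_keys_iff)
    then show False using has_end_below[OF assms] that by (auto simp: below_def)
  qed
qed

lemma has_end_single: "\<sigma> * \<sigma> = 1 \<Longrightarrow> has_end \<sigma> (single k u) (\<sigma> * k) u"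
  by (simp add: has_end_def below_def sign_mult_cancel)

lemma has_end_mult:
  assumes \<sigma>: "\<sigma> * \<sigma> = 1" and l: "has_end \<sigma> l h u" "has_end \<sigma> l' h' u'"
  shows "has_end \<sigma> (l * l') (h + h') (u * u')"
proof -
  define r where "r = l - single (\<sigma> * h) u"
  define r' where "r' = l' - single (\<sigma> * h') u'"
  have r: "below \<sigma> (h - 1) r" "below \<sigma> (h' - 1) r'"
    using l by (simp_all add: r_def r'_def has_end_def)
  have "below \<sigma> h (single (\<sigma> * h) u)"
    using \<sigma> by (simp add: below_def sign_mult_cancel)
  from below_mult[OF this r(2)] have "below \<sigma> (h + h' - 1) (single (\<sigma> * h) u * r')"
    by (simp add: algebra_simps)
  moreover from below_mult[OF r(1) has_end_below[OF \<sigma> l(2)]]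
  have "below \<sigma> (h + h' - 1) (r * l')" by (simp add: algebra_simps)
  ultimately have "below \<sigma> (h + h' - 1) (single (\<sigma> * h) u * r' + r * l')" by (rule below_add)
  moreover have "l * l' - single (\<sigma> * (h + h')) (u * u') = single (\<sigma> * h) u * r' + r * l'"
    by (simp add: r_def r'_def distrib_left left_diff_distrib right_diff_distrib mult_single)
  ultimately show ?thesis by (simp add: has_end_def)
qed

lemma has_end_one: "has_end \<sigma> 1 0 1"
  by (simp add: has_end_def below_def)

lemma has_end_power:
  "\<sigma> * \<sigma> = 1 \<Longrightarrow> has_end \<sigma> l h u \<Longrightarrow> has_end \<sigma> (l ^ m) (int m * h) (u ^ m)"
  by (induction m) (simp_all add: has_end_one has_end_mult distrib_right)

lemma has_end_prod:
  "\<sigma> * \<sigma> = 1 \<Longrightarrow> (\<And>j. j \<in> J \<Longrightarrow> has_end \<sigma> (l j) (h j) (u j)) \<Longrightarrow>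
    has_end \<sigma> (\<Prod>j\<in>J. l j) (\<Sum>j\<in>J. h j) (\<Prod>j\<in>J. u j)"
  by (induction J rule: infinite_finite_induct) (simp_all add: has_end_one has_end_mult)

lemma has_end_sum:
  assumes \<sigma>: "\<sigma> * \<sigma> = 1" and K: "finite K" "k \<in> K"
    and l: "\<And>e. e \<in> K \<Longrightarrow> has_end \<sigma> (l e) (h e) (u e)"
    and max: "\<And>e. e \<in> K \<Longrightarrow> e \<noteq> k \<Longrightarrow> h e < h k"
  shows "has_end \<sigma> (\<Sum>e\<in>K. l e) (h k) (u k)"
proof -
  have "below \<sigma> (h k - 1) (\<Sum>e\<in>K - {k}. l e)"
  proof (rule below_sum)
    fix e assume e: "e \<in> K - {k}"
    then have "below \<sigma> (h e) (l e)" using has_end_below[OF \<sigma> l] by blast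
    then show "below \<sigma> (h k - 1) (l e)" by (rule below_mono) (use max[of e] e in auto)
  qed
  then have "below \<sigma> (h k - 1) (l k - single (\<sigma> * h k) (u k) + (\<Sum>e\<in>K - {k}. l e))"
    using l[OF K(2)] by (intro below_add) (simp_all add: has_end_def)
  then show ?thesis using K by (simp add: has_end_def sum.remove[of K k] algebra_simps)
qed

lemma laurent_normal_form:
  fixes l :: "int \<Rightarrow>\<^sub>0 'a::comm_ring_1"
  assumes top: "has_end 1 l h u" "u \<noteq> 0" and bot: "has_end (-1) l h' u'"
  obtains P where "l = single (- h') 1 * laurent_of_poly P" "lead_coeff P = u" "coeff P 0 = u'"
proof -
  have top': "lookup l h = u" "\<And>i. i > h \<Longrightarrow> lookup l i = 0"
    using has_end_lookup[OF _ top(1)] by simp_all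
  have bot': "lookup l (- h') = u'" "\<And>i. i < - h' \<Longrightarrow> lookup l i = 0"
    using has_end_lookup[OF _ bot] by simp_all
  have "- h' \<le> h" using top' bot'(2)[of h] top(2) by (cases "h < - h'") auto
  define N where "N = nat (h + h')"
  have N: "int N = h + h'" using \<open>- h' \<le> h\<close> by (simp add: N_def)
  define P where "P = (\<Sum>i\<le>N. monom (lookup l (int i - h')) i)"
  have coeff_P: "coeff P i = (if i \<le> N then lookup l (int i - h') else 0)" for i
    by (simp add: P_def coeff_sum)
  have "degree P \<le> N" by (intro degree_le) (simp add: coeff_P)
  moreover have PN: "coeff P N = u" using top' N by (simp add: coeff_P)
  ultimately have deg: "degree P = N" using top(2) le_degree[of P N] by simp
  have "single (- h') 1 * laurent_of_poly P = (\<Sum>i\<le>N. single (int i - h') (lookup l (int i - h')))"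
    by (simp add: laurent_of_poly_def deg coeff_P sum_distrib_left mult_single)
  also have "\<dots> = (\<Sum>k\<in>{- h'..h}. single k (lookup l k))"
    by (rule sum.reindex_bij_witness[of _ "\<lambda>k. nat (k + h')" "\<lambda>i. int i - h'"]) (use N in auto)
  also have "\<dots> = (\<Sum>k\<in>keys l. single k (lookup l k))"
  proof (rule sum.mono_neutral_right)
    show "keys l \<subseteq> {- h'..h}"
    proof
      fix k assume "k \<in> keys l"
      then have "lookup l k \<noteq> 0" by (simp add: in_keys_iff)
      then show "k \<in> {- h'..h}" using top'(2)[of k] bot'(2)[of k] by (auto simp: not_less[symmetric])
    qed
  qed (auto simp: in_keys_iff)
  finally have "l = single (- h') 1 * laurent_of_poly P" by (simp add: sum_single_lookup)
  moreover have "coeff P 0 = u'" using bot' by (simp add: coeff_P)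
  ultimately show thesis using that deg PN by simp
qed

lemma ring_map_sum: "ring_map f \<Longrightarrow> f (\<Sum>x\<in>A. g x) = (\<Sum>x\<in>A. f (g x))"
  by (induction A rule: infinite_finite_induct) (simp_all add: ring_map_def)

lemma ring_map_prod: "ring_map f \<Longrightarrow> f (\<Prod>x\<in>A. g x) = (\<Prod>x\<in>A. f (g x))"
  by (induction A rule: infinite_finite_induct) (simp_all add: ring_map_def)

lemma ring_map_power: "ring_map f \<Longrightarrow> f (x ^ m) = f x ^ m"
  by (induction m) (simp_all add: ring_map_def)

lemma ring_map_diff: "ring_map f \<Longrightarrow> f (x - y) = f x - f y"
  unfolding ring_map_def by (metis add_diff_cancel_right' diff_add_cancel)

lemma prod_single: "(\<Prod>j\<in>J. single (f j) 1) = (single (\<Sum>j\<in>J. f j) 1 :: 'e::comm_monoid_add \<Rightarrow>\<^sub>0 'a::comm_ring_1)"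
  by (induction J rule: infinite_finite_induct) (simp_all add: mult_single)

lemma single_single_power:
  "single (single j 1) 1 ^ m = (single (single j (int m)) 1 :: (nat \<Rightarrow>\<^sub>0 int) \<Rightarrow>\<^sub>0 'a::comm_ring_1)"
  by (induction m) (simp_all add: mult_single single_add[symmetric])

text \<open>
  For fixed \<open>\<sigma>\<close> and distinct exponent vectors, the difference of the two weights is a nonzero
  integer polynomial in \<open>D\<close>, so all but finitely many \<open>D\<close> separate all vectors of \<open>K\<close>.\<close>

lemma separating_weights:
  fixes K :: "(nat \<Rightarrow>\<^sub>0 int) set" and d n :: nat
  assumes K: "finite K" "K \<subseteq> mixed_exponents d n"
  obtains D :: int where "D > 0"
    "\<And>\<sigma>. \<sigma> \<in> {1, -1} \<Longrightarrow>
      inj_on (\<lambda>e. \<sigma> * (\<Sum>i\<in>{1..d}. D ^ i * lookup e i) + (\<Sum>j\<in>{d<..n}. D ^ j * lookup e j)) K"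
proof -
  define p where "p \<sigma> e = (\<Sum>i\<in>{1..d}. monom (\<sigma> * lookup e i) i) + (\<Sum>j\<in>{d<..n}. monom (lookup e j) j)"
    for \<sigma> :: int and e :: "nat \<Rightarrow>\<^sub>0 int"
  have coeff_p: "coeff (p \<sigma> e) i = (if i \<in> {1..d} then \<sigma> * lookup e i else if i \<in> {d<..n} then lookup e i else 0)"
    for \<sigma> e i
    by (auto simp: p_def coeff_sum)
  have poly_p: "poly (p \<sigma> e) D = \<sigma> * (\<Sum>i\<in>{1..d}. D ^ i * lookup e i) + (\<Sum>j\<in>{d<..n}. D ^ j * lookup e j)"
    for \<sigma> e D
    by (simp add: p_def poly_sum poly_monom sum_distrib_left ac_simps)
  define B where "B = (\<Union>e\<in>K. \<Union>e'\<in>K - {e}. \<Union>\<sigma>\<in>{1, -1}. {D. poly (p \<sigma> e - p \<sigma> e') D = 0})"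
  have "finite {D. poly (p \<sigma> e - p \<sigma> e') D = 0}"
    if e: "e \<in> K" "e' \<in> K - {e}" "\<sigma> \<in> {1, -1}" for e e' \<sigma>
  proof (rule poly_roots_finite)
    show "p \<sigma> e - p \<sigma> e' \<noteq> 0"
    proof
      assume "p \<sigma> e - p \<sigma> e' = 0"
      then have eq: "coeff (p \<sigma> e) i = coeff (p \<sigma> e') i" for i by simp
      have "lookup e i = lookup e' i" for i
      proof (cases "i \<in> {1..d} \<or> i \<in> {d<..n}")
        case True
        then show ?thesis using eq[of i] e(3) by (auto simp: coeff_p split: if_splits)
      next
        case False
        then have "i \<notin> {1..n}" by auto
        then have "i \<notin> keys e" "i \<notin> keys e'" using e(1,2) K(2) unfolding mixed_exponents_def by blast+
        then show ?thesis by (simp add: in_keys_iff)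
      qed
      then have "e = e'" by (rule poly_mapping_eqI)
      then show False using e by simp
    qed
  qed
  then have "finite B" using K(1) by (simp add: B_def)
  define D where "D = 1 + Max (insert 0 B)"
  have "D > b" if "b \<in> insert 0 B" for b
  proof -
    have "b \<le> Max (insert 0 B)" using \<open>finite B\<close> that by (intro Max_ge) auto
    then show ?thesis unfolding D_def by linarith
  qed
  then have D: "D > 0" "D \<notin> B" by blast+
  show thesis
  proof (rule that[OF D(1)])
    fix \<sigma> :: int assume \<sigma>: "\<sigma> \<in> {1, -1}"
    show "inj_on (\<lambda>e. \<sigma> * (\<Sum>i\<in>{1..d}. D ^ i * lookup e i) + (\<Sum>j\<in>{d<..n}. D ^ j * lookup e j)) K"
      unfolding poly_p[symmetric] using D(2) \<sigma> by (fastforce simp: B_def inj_on_def)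
  qed
qed


section \<open>A substitution that makes an entry monic at both ends\<close>

text \<open>
  Every index has an invertible variable, with exponents in the first component, and a
  polynomial variable, with exponents in the second.\<close>

type_synonym 'k split_laurent = "((nat \<Rightarrow>\<^sub>0 int) \<times> (nat \<Rightarrow>\<^sub>0 nat)) \<Rightarrow>\<^sub>0 'k"

definition laurent_part :: "nat \<Rightarrow> (nat \<Rightarrow>\<^sub>0 int) \<Rightarrow> (nat \<Rightarrow>\<^sub>0 int)" where
  "laurent_part d e = (\<Sum>i\<in>{1..d}. single i (lookup e i))"

text \<open>The polynomial variable \<open>s\<^sub>j\<close> is replaced by \<open>s\<^sub>j + x\<^sup>N - x\<^sup>-\<^sup>N\<close>, which is \<open>s\<^sub>j\<close> at \<open>x = 1\<close>.\<close>

definition shifted_var :: "int \<Rightarrow> nat \<Rightarrow> (int \<Rightarrow>\<^sub>0 'k::field split_laurent)" where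
  "shifted_var N j = single 0 (single (0, single j 1) 1) + single N 1 - single (- N) 1"

text \<open>
  The truncation \<open>nat\<close> is harmless, as exponents of polynomial variables are not negative.\<close>

definition shifted_monomial :: "nat \<Rightarrow> nat \<Rightarrow> int \<Rightarrow> (nat \<Rightarrow>\<^sub>0 int) \<Rightarrow> (int \<Rightarrow>\<^sub>0 'k::field split_laurent)" where
  "shifted_monomial d n D e =
    single (\<Sum>i\<in>{1..d}. D ^ i * lookup e i) (single (laurent_part d e, 0) 1) *
    (\<Prod>j\<in>{d<..n}. shifted_var (D ^ j) j ^ nat (lookup e j))"

definition shift :: "nat \<Rightarrow> nat \<Rightarrow> int \<Rightarrow> ((nat \<Rightarrow>\<^sub>0 int) \<Rightarrow>\<^sub>0 'k::field) \<Rightarrow> (int \<Rightarrow>\<^sub>0 'k split_laurent)" where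
  "shift d n D = monomial_eval (single 0 \<circ> single 0) (shifted_monomial d n D)"

definition merge_exponents :: "nat \<Rightarrow> nat \<Rightarrow> (nat \<Rightarrow>\<^sub>0 int) \<times> (nat \<Rightarrow>\<^sub>0 nat) \<Rightarrow> (nat \<Rightarrow>\<^sub>0 int)" where
  "merge_exponents d n x =
    (\<Sum>i\<in>{1..d}. single i (lookup (fst x) i)) + (\<Sum>j\<in>{d<..n}. single j (int (lookup (snd x) j)))"

text \<open>
  The retraction onto the mixed ring: the variables of the wrong kind for their index, and those
  with index outside \<open>{1..n}\<close>, are evaluated at \<open>1\<close>.\<close>

definition merge :: "nat \<Rightarrow> nat \<Rightarrow> 'k::field split_laurent \<Rightarrow> ((nat \<Rightarrow>\<^sub>0 int) \<Rightarrow>\<^sub>0 'k)" where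
  "merge d n = monomial_eval (single 0) (\<lambda>x. single (merge_exponents d n x) 1)"

lemma shifted_monomial_add:
  assumes "e \<in> mixed_exponents d n" "e' \<in> mixed_exponents d n"
  shows "shifted_monomial d n D (e + e') = shifted_monomial d n D e * shifted_monomial d n D e'"
proof -
  have "nat (lookup (e + e') j) = nat (lookup e j) + nat (lookup e' j)" if "j \<in> {d<..n}" for j
    using assms that by (auto simp: mixed_exponents_def lookup_add nat_add_distrib)
  then have prod: "(\<Prod>j\<in>{d<..n}. shifted_var (D ^ j) j ^ nat (lookup (e + e') j)) =
      (\<Prod>j\<in>{d<..n}. shifted_var (D ^ j) j ^ nat (lookup e j)) *
      (\<Prod>j\<in>{d<..n}. shifted_var (D ^ j) j ^ nat (lookup e' j) :: int \<Rightarrow>\<^sub>0 'a split_laurent)"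
    by (simp add: power_add prod.distrib)
  have part: "laurent_part d (e + e') = laurent_part d e + laurent_part d e'"
    by (simp add: laurent_part_def lookup_add single_add sum.distrib)
  have weight: "(\<Sum>i\<in>{1..d}. D ^ i * lookup (e + e') i) =
      (\<Sum>i\<in>{1..d}. D ^ i * lookup e i) + (\<Sum>i\<in>{1..d}. D ^ i * lookup e' i)"
    by (simp add: lookup_add distrib_left sum.distrib)
  have split: "single (a + b) (single (x + y, 0) 1) = single a (single (x, 0) 1) * single b (single (y, 0) (1::'a))"
    for a b :: int and x y :: "nat \<Rightarrow>\<^sub>0 int"
    by (simp add: mult_single plus_prod_def)
  show ?thesis
    unfolding shifted_monomial_def prod part weight split by (simp only: mult.assoc mult.left_commute)
qed

lemma ring_map_constants:
  "ring_map (single 0 \<circ> single 0 :: 'k::field \<Rightarrow> int \<Rightarrow>\<^sub>0 'k split_laurent)"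
  by (intro ring_map_comp ring_map_single)

lemma ring_map_merge: "ring_map (merge d n)"
  unfolding merge_def
proof (rule ring_map_monomial_eval)
  show "single (merge_exponents d n 0) 1 = (1 :: (nat \<Rightarrow>\<^sub>0 int) \<Rightarrow>\<^sub>0 'a)"
    by (simp add: merge_exponents_def)
  show "single (merge_exponents d n (x + y)) 1 =
      single (merge_exponents d n x) 1 * (single (merge_exponents d n y) 1 :: (nat \<Rightarrow>\<^sub>0 int) \<Rightarrow>\<^sub>0 'a)" for x y
    by (simp add: merge_exponents_def mult_single lookup_add single_add sum.distrib ac_simps)
qed (rule ring_map_single)

lemma merge_0: "merge d n 0 = 0" and merge_1: "merge d n 1 = 1"
  using ring_map_merge unfolding ring_map_def by blast+

lemma merge_single: "merge d n (single x c) = single (merge_exponents d n x) c"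
  by (simp add: merge_def monomial_eval_single ring_map_single mult_single)

lemma merge_in_carrier:
  assumes "d \<le> n" shows "merge d n p \<in> carrier (mixed_laurent d n)"
proof -
  interpret R: cring "mixed_laurent d n :: ((nat \<Rightarrow>\<^sub>0 int) \<Rightarrow>\<^sub>0 'a) ring"
    by (rule mixed_laurent_cring)
  have "merge_exponents d n x \<in> mixed_exponents d n" for x
  proof -
    have look: "lookup (merge_exponents d n x) k =
        (if k \<in> {1..d} then lookup (fst x) k else if k \<in> {d<..n} then int (lookup (snd x) k) else 0)" for k
      by (auto simp: merge_exponents_def lookup_add lookup_sum lookup_single when_def sum.delta)
    then show ?thesis using assms by (auto simp: mixed_exponents_def in_keys_iff split: if_splits)
  qed
  then have monomial: "single (merge_exponents d n x) c \<in> carrier (mixed_laurent d n)" for x and c :: 'a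
    by (simp add: mixed_laurent_def)
  have add: "a + b \<in> carrier (mixed_laurent d n)"
    if "a \<in> carrier (mixed_laurent d n)" "b \<in> carrier (mixed_laurent d n)" for a b :: "(nat \<Rightarrow>\<^sub>0 int) \<Rightarrow>\<^sub>0 'a"
    using R.a_closed[OF that] by (simp add: mixed_laurent_def)
  have zero: "0 \<in> carrier (mixed_laurent d n :: ((nat \<Rightarrow>\<^sub>0 int) \<Rightarrow>\<^sub>0 'a) ring)"
    by (simp add: mixed_laurent_def)
  have "(\<Sum>x\<in>A. single (merge_exponents d n x) (lookup p x)) \<in> carrier (mixed_laurent d n)" for A
    by (induction A rule: infinite_finite_induct) (simp_all add: zero add monomial)
  then show ?thesis by (simp add: merge_def monomial_eval_def mult_single)
qed

lemma merge_shift: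
  fixes p :: "(nat \<Rightarrow>\<^sub>0 int) \<Rightarrow>\<^sub>0 'k::field"
  assumes "p \<in> carrier (mixed_laurent d n)"
  shows "merge d n (laurent_at_one (shift d n D p)) = p"
proof -
  let ?f = "\<lambda>l :: int \<Rightarrow>\<^sub>0 'k split_laurent. merge d n (laurent_at_one l)"
  have f: "ring_map ?f"
    using ring_map_comp[OF ring_map_laurent_at_one ring_map_merge] by (simp add: comp_def)
  have var: "?f (shifted_var N j) = single (single j 1) 1" if "j \<in> {d<..n}" for N j
  proof -
    have at_one: "laurent_at_one (shifted_var N j) = single (0, single j 1) (1::'k)"
      by (simp add: shifted_var_def laurent_at_one_hom ring_map_diff[OF ring_map_laurent_at_one])
    have exps: "merge_exponents d n (0, single j 1) = single j 1"
      using that by (simp add: merge_exponents_def lookup_single when_def if_distrib[of "single _"]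
          if_distrib[of int] sum.delta cong: if_cong)
    show ?thesis by (simp only: at_one merge_single exps)
  qed
  have mon: "?f (shifted_monomial d n D e) = single e 1" if e: "e \<in> mixed_exponents d n" for e
  proof -
    have "?f (shifted_monomial d n D e) = single (merge_exponents d n (laurent_part d e, 0)) 1 *
        (\<Prod>j\<in>{d<..n}. ?f (shifted_var (D ^ j) j) ^ nat (lookup e j))"
      using f by (simp add: shifted_monomial_def ring_map_def[of ?f] ring_map_prod[OF f] ring_map_power[OF f] merge_single)
    also have "(\<Prod>j\<in>{d<..n}. ?f (shifted_var (D ^ j) j) ^ nat (lookup e j)) =
        (\<Prod>j\<in>{d<..n}. single (single j (lookup e j)) 1)"
      using e by (intro prod.cong refl) (auto simp: var single_single_power mixed_exponents_def)
    also have "\<dots> = single (\<Sum>j\<in>{d<..n}. single j (lookup e j)) 1" by (rule prod_single)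
    also have "single (merge_exponents d n (laurent_part d e, 0)) 1 * \<dots> =
        single (merge_exponents d n (laurent_part d e, 0) + (\<Sum>j\<in>{d<..n}. single j (lookup e j))) (1::'k)"
      by (simp add: mult_single)
    also have "merge_exponents d n (laurent_part d e, 0) + (\<Sum>j\<in>{d<..n}. single j (lookup e j)) = e"
    proof (rule poly_mapping_eqI)
      fix k
      have "k \<notin> {1..n} \<Longrightarrow> lookup e k = 0"
        using e by (auto simp: mixed_exponents_def in_keys_iff)
      then show "lookup (merge_exponents d n (laurent_part d e, 0) + (\<Sum>j\<in>{d<..n}. single j (lookup e j))) k = lookup e k"
        by (auto simp: merge_exponents_def laurent_part_def lookup_add lookup_sum lookup_single when_def sum.delta)
    qed
    finally show ?thesis .
  qed
  have "?f (shift d n D p) = (\<Sum>e\<in>keys p. single 0 (lookup p e) * ?f (shifted_monomial d n D e))"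
    using f by (simp add: shift_def monomial_eval_def ring_map_sum[OF f] ring_map_def[of ?f] merge_single
        merge_exponents_def)
  also have "\<dots> = (\<Sum>e\<in>keys p. single e (lookup p e))"
    using assms by (intro sum.cong refl) (auto simp: mon mult_single mixed_laurent_def)
  finally show ?thesis by (simp add: sum_single_lookup)
qed

lemma shift_hom:
  fixes p q :: "(nat \<Rightarrow>\<^sub>0 int) \<Rightarrow>\<^sub>0 'k::field"
  assumes "p \<in> carrier (mixed_laurent d n)" "q \<in> carrier (mixed_laurent d n)"
  shows "shift d n D (p + q) = shift d n D p + shift d n D q"
    and "shift d n D (p * q) = shift d n D p * shift d n D q"
proof -
  show "shift d n D (p + q) = shift d n D p + shift d n D q"
    unfolding shift_def by (rule monomial_eval_add[OF ring_map_constants])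
  show "shift d n D (p * q) = shift d n D p * shift d n D q"
    unfolding shift_def
    by (rule monomial_eval_mult[OF ring_map_constants shifted_monomial_add])
      (use assms in \<open>simp_all add: mixed_laurent_def\<close>)
qed

lemma shift_one: "shift d n D (1 :: (nat \<Rightarrow>\<^sub>0 int) \<Rightarrow>\<^sub>0 'k::field) = 1"
  unfolding shift_def
  by (rule monomial_eval_one[OF ring_map_constants])
    (simp add: shifted_monomial_def laurent_part_def flip: zero_prod_def)

lemma has_end_shifted_var:
  assumes "N > 0" "\<sigma> \<in> {1, -1}"
  shows "has_end \<sigma> (shifted_var N j) N (of_int \<sigma>)"
proof -
  let ?s = "single 0 (single (0, single j 1) 1) :: int \<Rightarrow>\<^sub>0 'a split_laurent"
  have "shifted_var N j - single N 1 = ?s + single (- N) (- 1)"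
    "shifted_var N j - single (- N) (- 1) = ?s + single N 1"
    by (simp_all add: shifted_var_def single_uminus)
  then show ?thesis
    using assms by (auto simp: has_end_def intro!: below_add below_single)
qed

lemma unit_mult: "a dvd 1 \<Longrightarrow> b dvd 1 \<Longrightarrow> a * b dvd 1" for a b :: "'a::comm_ring_1"
  using mult_dvd_mono[of a 1 b 1] by simp

lemma unit_power: "a dvd 1 \<Longrightarrow> a ^ m dvd 1" for a :: "'a::comm_ring_1"
  by (induction m) (simp_all add: unit_mult)

lemma unit_prod: "(\<And>j. j \<in> J \<Longrightarrow> f j dvd 1) \<Longrightarrow> (\<Prod>j\<in>J. f j) dvd 1" for f :: "'b \<Rightarrow> 'a::comm_ring_1"
  by (induction J rule: infinite_finite_induct) (simp_all add: unit_mult)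

text \<open>
  At either end the shifted monomial with exponent vector \<open>e\<close> has, up to sign, a monomial in
  the invertible variables as its coefficient; since \<open>k\<close> is a field, the coefficient of \<open>e\<close> in \<open>p\<close> is invertible too.
  The weights separate the exponent vectors, so one of these terms dominates.\<close>

lemma shift_invertible_ends:
  fixes p :: "(nat \<Rightarrow>\<^sub>0 int) \<Rightarrow>\<^sub>0 'k::field"
  assumes p: "p \<in> carrier (mixed_laurent d n)" "p \<noteq> 0" and D: "D > 0" and \<sigma>: "\<sigma> \<in> {1, -1}"
    and inj: "inj_on (\<lambda>e. \<sigma> * (\<Sum>i\<in>{1..d}. D ^ i * lookup e i) + (\<Sum>j\<in>{d<..n}. D ^ j * lookup e j)) (keys p)"
  obtains h u where "has_end \<sigma> (shift d n D p) h u" "u dvd 1"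
proof -
  define h where "h e = \<sigma> * (\<Sum>i\<in>{1..d}. D ^ i * lookup e i) + (\<Sum>j\<in>{d<..n}. D ^ j * lookup e j)"
    for e :: "nat \<Rightarrow>\<^sub>0 int"
  define s :: "'k split_laurent" where "s = of_int \<sigma>"
  define u where "u e = single 0 (lookup p e) * (single (laurent_part d e, 0) 1 *
    (\<Prod>j\<in>{d<..n}. s ^ nat (lookup e j)))" for e
  have \<sigma>\<sigma>: "\<sigma> * \<sigma> = 1" using \<sigma> by auto
  have "s dvd 1" using \<sigma> by (auto simp: s_def)
  have u_unit: "u e dvd 1" if "e \<in> keys p" for e
  proof -
    have "single (0 :: (nat \<Rightarrow>\<^sub>0 int) \<times> (nat \<Rightarrow>\<^sub>0 nat)) (lookup p e) * single 0 (inverse (lookup p e)) = 1"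
      using that by (simp add: mult_single in_keys_iff)
    then have "single (0 :: (nat \<Rightarrow>\<^sub>0 int) \<times> (nat \<Rightarrow>\<^sub>0 nat)) (lookup p e) dvd 1" by (metis dvd_triv_left)
    moreover have "single (laurent_part d e, 0 :: nat \<Rightarrow>\<^sub>0 nat) (1::'k) * single (- laurent_part d e, 0) 1 = 1"
      by (simp add: mult_single plus_prod_def flip: zero_prod_def)
    then have "single (laurent_part d e, 0 :: nat \<Rightarrow>\<^sub>0 nat) (1::'k) dvd 1" by (metis dvd_triv_left)
    moreover have "(\<Prod>j\<in>{d<..n}. s ^ nat (lookup e j)) dvd 1"
      using \<open>s dvd 1\<close> by (intro unit_prod unit_power)
    ultimately show ?thesis unfolding u_def by (intro unit_mult)
  qed
  have ends: "has_end \<sigma> ((single 0 \<circ> single 0) (lookup p e) * shifted_monomial d n D e) (h e) (u e)"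
    if "e \<in> keys p" for e
  proof -
    have "e \<in> mixed_exponents d n" using that p by (auto simp: mixed_laurent_def)
    then have nonneg: "lookup e j \<ge> 0" if "j \<in> {d<..n}" for j
      using that by (simp add: mixed_exponents_def)
    have "has_end \<sigma> (\<Prod>j\<in>{d<..n}. shifted_var (D ^ j) j ^ nat (lookup e j))
        (\<Sum>j\<in>{d<..n}. int (nat (lookup e j)) * D ^ j) (\<Prod>j\<in>{d<..n}. s ^ nat (lookup e j))"
      unfolding s_def using D \<sigma> by (intro has_end_prod has_end_power has_end_shifted_var \<sigma>\<sigma>) auto
    also have "(\<Sum>j\<in>{d<..n}. int (nat (lookup e j)) * D ^ j) = (\<Sum>j\<in>{d<..n}. D ^ j * lookup e j)"
      using nonneg by (intro sum.cong refl) (simp add: mult.commute)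
    finally have "has_end \<sigma> (single 0 (single 0 (lookup p e)) * shifted_monomial d n D e) (\<sigma> * 0 + h e) (u e)"
      unfolding shifted_monomial_def h_def u_def
      by (intro has_end_mult has_end_single \<sigma>\<sigma>)
    then show ?thesis by simp
  qed
  have fin: "finite (keys p)" "keys p \<noteq> {}" using p(2) by simp_all
  then have "Max (h ` keys p) \<in> h ` keys p" by (intro Max_in) auto
  then obtain k where k: "k \<in> keys p" "h k = Max (h ` keys p)" by (metis imageE)
  have "h e < h k" if "e \<in> keys p" "e \<noteq> k" for e
  proof -
    have "h e \<le> h k" using that fin k by simp
    moreover have "h e \<noteq> h k" using inj that k unfolding h_def[symmetric] inj_on_def by blast
    ultimately show ?thesis by simp
  qed
  then have "has_end \<sigma> (shift d n D p) (h k) (u k)"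
    unfolding shift_def monomial_eval_def using fin k(1) ends by (intro has_end_sum[OF \<sigma>\<sigma>]) auto
  then show thesis using u_unit[OF k(1)] that by blast
qed

section \<open>Rows and isotopes over mixed Laurent polynomial rings\<close>

lemma sl2_equiv_merge:
  fixes x1 x2 x3 x4 y1 y2 y3 y4 :: "'k::field split_laurent"
  assumes d: "d \<le> n" and eq: "sl2_equiv UNIV (x1, x2, x3, x4) (y1, y2, y3, y4)"
  shows "sl2_equiv (carrier (mixed_laurent d n)) (merge d n x1, merge d n x2, merge d n x3, merge d n x4)
    (merge d n y1, merge d n y2, merge d n y3, merge d n y4)"
proof -
  let ?m = "merge d n"
  define f where "f = (\<lambda>(x1 :: 'k split_laurent, x2 :: 'k split_laurent, x3 :: 'k split_laurent, x4 :: 'k split_laurent).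
    (?m x1, ?m x2, ?m x3, ?m x4))"
  have hom: "?m 1 = 1" "?m (x + y) = ?m x + ?m y" "?m (x * y) = ?m x * ?m y"
    for x y :: "'k split_laurent"
    using ring_map_merge unfolding ring_map_def by blast+
  have det: "?m a * ?m d' - ?m b * ?m c = 1" if "a * d' - b * c = 1"
    for a b c d' :: "'k split_laurent"
    using arg_cong[OF that, of ?m] by (simp add: hom ring_map_diff[OF ring_map_merge])
  have step: "sl2_step (carrier (mixed_laurent d n)) (f x) (f y)" if "sl2_step UNIV x y" for x y
    using that
    by cases (auto simp: f_def hom intro!: sl2_12 sl2_13 sl2_14 det merge_in_carrier[OF d])
  have "sl2_equiv (carrier (mixed_laurent d n)) (f x) (f y)" if "sl2_equiv UNIV x y" for x y
    using that by (induction rule: rtranclp_induct) (auto intro: rtranclp.rtrancl_into_rtrancl step)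
  from this[OF eq] show ?thesis by (simp add: f_def)
qed

text \<open>
  A row over the mixed ring is shifted, moved to \<open>(1, 0, 0, 0)\<close> over the large ring after setting
  \<open>x = 1\<close>, and brought back by \<open>merge\<close>.\<close>

theorem unimodular_row_sl2_equiv:
  fixes a1 a2 a3 a4 :: "(nat \<Rightarrow>\<^sub>0 int) \<Rightarrow>\<^sub>0 'k::field"
  assumes d: "d \<le> n"
    and S: "{a1, a2, a3, a4, b1, b2, b3, b4} \<subseteq> carrier (mixed_laurent d n)"
    and um: "b1 * a1 + b2 * a2 + b3 * a3 + b4 * a4 = 1"
  shows "sl2_equiv (carrier (mixed_laurent d n)) (a1, a2, a3, a4) (1, 0, 0, 0)"
proof -
  define C where "C = carrier (mixed_laurent d n :: ((nat \<Rightarrow>\<^sub>0 int) \<Rightarrow>\<^sub>0 'k) ring)"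
  interpret R: cring "mixed_laurent d n :: ((nat \<Rightarrow>\<^sub>0 int) \<Rightarrow>\<^sub>0 'k) ring"
    by (rule mixed_laurent_cring)
  have add: "x + y \<in> C" if "x \<in> C" "y \<in> C" for x y
    using R.a_closed[of x y] that unfolding C_def by (simp add: mixed_laurent_def)
  have mult: "x * y \<in> C" if "x \<in> C" "y \<in> C" for x y
    using R.m_closed[of x y] that unfolding C_def by (simp add: mixed_laurent_def)
  have uminus: "- x \<in> C" if "x \<in> C" for x
    using that unfolding C_def by (simp add: mixed_laurent_def)
  have one: "0 \<in> C" "1 \<in> C" using R.zero_closed R.one_closed unfolding C_def by (simp_all add: mixed_laurent_def)
  note closed = add mult uminus one
  have S': "a1 \<in> C" "a2 \<in> C" "a3 \<in> C" "a4 \<in> C" "b1 \<in> C" "b2 \<in> C" "b3 \<in> C" "b4 \<in> C"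
    using S by (simp_all add: C_def)
  \<comment> \<open>The first entry has to be nonzero for the substitution to make it monic; otherwise another entry is added to it.\<close>
  obtain r s t where rst: "{r, s, t} \<subseteq> C" and nonzero: "a1 + r * a2 + s * a3 + t * a4 \<noteq> 0"
  proof -
    have "a1 \<noteq> 0 \<or> a2 \<noteq> 0 \<or> a3 \<noteq> 0 \<or> a4 \<noteq> 0" using um by auto
    then show thesis
      using that[of 0 0 0] that[of 1 0 0] that[of 0 1 0] that[of 0 0 1] one by fastforce
  qed
  define c where "c = a1 + r * a2 + s * a3 + t * a4"
  have c: "c \<in> C" "c \<noteq> 0" using S' rst nonzero by (simp_all add: c_def closed)
  have "keys c \<subseteq> mixed_exponents d n" using c(1) by (simp add: C_def mixed_laurent_def)
  then obtain D :: int where D: "D > 0" "\<And>\<sigma>. \<sigma> \<in> {1, -1} \<Longrightarrow>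
      inj_on (\<lambda>e. \<sigma> * (\<Sum>i\<in>{1..d}. D ^ i * lookup e i) + (\<Sum>j\<in>{d<..n}. D ^ j * lookup e j)) (keys c)"
    using separating_weights[OF finite_keys] by blast
  let ?F = "shift d n D"
  obtain h u where top: "has_end 1 (?F c) h u" "u dvd 1"
    using shift_invertible_ends[OF c(1)[unfolded C_def] c(2) D(1) _ D(2), of 1] by auto
  obtain h' u' where bot: "has_end (-1) (?F c) h' u'" "u' dvd 1"
    using shift_invertible_ends[OF c(1)[unfolded C_def] c(2) D(1) _ D(2), of "-1"] by auto
  have "u \<noteq> 0" using top(2) by auto
  then obtain P where P: "?F c = single (- h') 1 * laurent_of_poly P" "lead_coeff P = u" "coeff P 0 = u'"
    using laurent_normal_form[OF top(1) _ bot(1)] by blast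
  obtain v v' where v: "lead_coeff P * v = 1" "coeff P 0 * v' = 1"
  proof -
    from top(2) obtain v where v: "1 = u * v" by (rule dvdE)
    from bot(2) obtain v' where v': "1 = u' * v'" by (rule dvdE)
    show thesis by (rule that[of v v']) (simp_all only: P(2,3) v[symmetric] v'[symmetric])
  qed
  have hom: "?F (x + y) = ?F x + ?F y" "?F (x * y) = ?F x * ?F y" if "x \<in> C" "y \<in> C" for x y
    by (simp_all only: shift_hom[OF that[unfolded C_def]])
  have "b1 * c + (b2 - b1 * r) * a2 + (b3 - b1 * s) * a3 + (b4 - b1 * t) * a4 = 1"
    using um by (simp add: c_def algebra_simps)
  then have "?F (b1 * c + (b2 + - (b1 * r)) * a2 + (b3 + - (b1 * s)) * a3 + (b4 + - (b1 * t)) * a4) = 1"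
    by (simp add: shift_one)
  then have "?F b1 * ?F c + ?F (b2 + - (b1 * r)) * ?F a2 + ?F (b3 + - (b1 * s)) * ?F a3
      + ?F (b4 + - (b1 * t)) * ?F a4 = 1"
    using S' rst c(1) by (simp only: hom closed insert_subset)
  from laurent_row_sl2_equiv[OF this P(1) v]
  have "sl2_equiv UNIV (laurent_at_one (?F c), laurent_at_one (?F a2), laurent_at_one (?F a3),
      laurent_at_one (?F a4)) (1, 0, 0, 0)" .
  moreover have "?F c = ?F a1 + ?F r * ?F a2 + ?F s * ?F a3 + ?F t * ?F a4"
    unfolding c_def using S' rst by (simp only: hom closed insert_subset)
  then have "sl2_equiv UNIV (laurent_at_one (?F a1), laurent_at_one (?F a2), laurent_at_one (?F a3),
      laurent_at_one (?F a4)) (laurent_at_one (?F c), laurent_at_one (?F a2), laurent_at_one (?F a3),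
      laurent_at_one (?F a4))"
    by (simp only: laurent_at_one_hom) (rule sl2_equiv_add_to_first)
  ultimately have "sl2_equiv UNIV (laurent_at_one (?F a1), laurent_at_one (?F a2), laurent_at_one (?F a3),
      laurent_at_one (?F a4)) (1, 0, 0, 0)" by (rule rtranclp_trans[rotated])
  from sl2_equiv_merge[OF d this] show ?thesis
    using S by (simp add: merge_shift merge_0 merge_1)
qed

theorem corollary7p8:
  fixes d n :: nat
    and R :: "((nat \<Rightarrow>\<^sub>0 int) \<Rightarrow>\<^sub>0 'k::field) ring"
    and A :: "((nat \<Rightarrow>\<^sub>0 int) \<Rightarrow>\<^sub>0 'k, 'a) module"
  assumes "d \<le> n"
    and "R = mixed_laurent d n"
    and "isotope_of R A (zorn_algebra R)"
  shows "split_octonion R A"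
proof -
  interpret subring_record "carrier R" R
    by (rule subring_record.intro) (simp_all add: assms(2) mixed_laurent_cring, simp add: mixed_laurent_def)
  show ?thesis
  proof (rule isotope_split)
    fix a u1 u2 u3 p q1 q2 q3 :: "(nat \<Rightarrow>\<^sub>0 int) \<Rightarrow>\<^sub>0 'k"
    assume "{a, u1, u2, u3, p, q1, q2, q3} \<subseteq> carrier R" "p * a + q1 * u1 + q2 * u2 + q3 * u3 = 1"
    then show "sl2_equiv (carrier R) (a, u1, u2, u3) (1, 0, 0, 0)"
      unfolding assms(2) by (rule unimodular_row_sl2_equiv[OF assms(1)])
  qed (rule assms(3))
qed

end
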